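(* For every $\gamma\in\mathrm{PSL}(2,\mathbb{Z})$ there exists a sequence $\{u_i(\gamma)\}_{i\ge 0}$ of real numbers such that $u_0(\gamma)=\rho(\lambda(\gamma))$ and $$\left|\mathbb{E}_n\left[\mathrm{tr}\,\Pi_\gamma\right]-\sum_{i=0}^{m-1}\frac{u_i(\gamma)}{(6n)^i}\right|\le\frac{(18m)^{18m}}{(6n)^m}$$ for all integers $m\ge|\gamma|+1$ and all $n\ge 1$ with $6n\ge 18m^{18}$.
   Context: For $n\ge1$, $\mathcal{E}_n$ is the set of pairs $(\sigma,\tau)$ of permutations in $S_{6n}$ such that $\sigma$ has order $2$ and no fixed point (a product of $3n$ disjoint transpositions) and $\tau$ has order $3$ and no fixed point (a product of $2n$ disjoint $3$-cycles). $\mathbb{E}_n$ is the expectation with respect to the uniform probability measure on $\mathcal{E}_n$. $\mathrm{PSL}(2,\mathbb{Z})\simeq\mathbb{Z}_2\star\mathbb{Z}_3$ is generated by $b=\begin{pmatrix}0&1\\-1&0\end{pmatrix}$ (order 2) and $c=\begin{pmatrix}0&1\\-1&1\end{pmatrix}$ (order 3). For $\gamma\in\mathrm{PSL}(2,\mathbb{Z})$, $|\gamma|$ is the minimal length of a word in the letters $b,c$ (without $c^{-1}$) representing $\gamma$. For $(\sigma,\tau)\in\mathcal{E}_n$, $\Phi(\sigma,\tau):\mathrm{PSL}(2,\mathbb{Z})\to S_{6n}$ is the homomorphism with $b\mapsto\sigma$, $c\mapsto\tau$. $\mathrm{std}:S_{6n}\to\mathcal{U}(6n-1)$ is the $(6n-1)$-dimensional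 irreducible subrepresentation of the permutation representation of $S_{6n}$ obtained by removing the invariant vectors. The random variable $\mathrm{tr}\,\Pi_\gamma:\mathcal{E}_n\to\mathbb{R}$ is $$\mathrm{tr}\,\Pi_\gamma(\sigma,\tau)=\frac{1}{6n}\mathrm{Tr}\left(\mathrm{std}\circ\Phi(\sigma,\tau)(\gamma)\right),$$ with $\mathrm{Tr}$ the usual (unnormalized) matrix trace. $\lambda$ is the left regular representation of $\mathrm{PSL}(2,\mathbb{Z})$ on $\ell^2(\mathrm{PSL}(2,\mathbb{Z}))$, $\lambda(\gamma)[f](x)=f(\gamma^{-1}x)$, and $\rho(\varphi)=\langle\delta_e,\varphi\delta_e\rangle$ is the canonical trace, so $\rho(\lambda(\gamma))=1$ if $\gamma=e$ and $0$ otherwise. *)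

theory Defs
  imports
    "HOL-Probability.Probability_Mass_Function"
    "HOL-Algebra.Sym_Groups"
    "HOL-Algebra.Multiplicative_Group"
    "Jordan_Normal_Form.Gram_Schmidt"
begin

section \<open>The modular group and word length\<close>

definition SL2Z :: "int mat monoid" where
  "SL2Z = \<lparr>carrier = {A \<in> carrier_mat 2 2. Determinant.det A = 1},
           mult = (*), one = 1\<^sub>m 2\<rparr>"

definition SL2Z_center :: "int mat set" where
  "SL2Z_center = {1\<^sub>m 2, - 1\<^sub>m 2}"

text \<open>Elements of PSL(2,Z) are cosets of \<open>{I, -I}\<close>.\<close>

definition PSL2Z :: "int mat set monoid" where
  "PSL2Z = SL2Z Mod SL2Z_center"

definition PSL2Z_b :: "int mat set" where
  "PSL2Z_b = SL2Z_center #>\<^bsub>SL2Z\<^esub> mat_of_rows_list 2 [[0, 1], [-1, 0]]"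

definition PSL2Z_c :: "int mat set" where
  "PSL2Z_c = SL2Z_center #>\<^bsub>SL2Z\<^esub> mat_of_rows_list 2 [[0, 1], [-1, 1]]"

text \<open>Inverses of the letters are not letters, and the empty word represents the identity.\<close>

definition word_length :: "('a, 'b) monoid_scheme \<Rightarrow> 'a set \<Rightarrow> 'a \<Rightarrow> nat" where
  "word_length G S g =
     (LEAST k. \<exists>w. length w = k \<and> set w \<subseteq> S \<and> foldr (\<otimes>\<^bsub>G\<^esub>) w \<one>\<^bsub>G\<^esub> = g)"

section \<open>Random homomorphisms to the symmetric group\<close>

definition rand_pairs :: "nat \<Rightarrow> ((nat \<Rightarrow> nat) \<times> (nat \<Rightarrow> nat)) set" where
  "rand_pairs n = {(\<sigma>, \<tau>).
     \<sigma> \<in> carrier (sym_group (6 * n)) \<and> group.ord (sym_group (6 * n)) \<sigma> = 2 \<and>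
       (\<forall>i\<in>{1..6 * n}. \<sigma> i \<noteq> i) \<and>
     \<tau> \<in> carrier (sym_group (6 * n)) \<and> group.ord (sym_group (6 * n)) \<tau> = 3 \<and>
       (\<forall>i\<in>{1..6 * n}. \<tau> i \<noteq> i)}"

text \<open>The restriction to extensional functions only pins down the (irrelevant) values
  outside the carrier, so that the homomorphism is unique as a HOL function.\<close>

definition Phi ::
  "nat \<Rightarrow> (nat \<Rightarrow> nat) \<times> (nat \<Rightarrow> nat) \<Rightarrow> int mat set \<Rightarrow> (nat \<Rightarrow> nat)" where
  "Phi n = (\<lambda>(\<sigma>, \<tau>).
     THE \<phi>. \<phi> \<in> hom PSL2Z (sym_group (6 * n)) \<inter> extensional (carrier PSL2Z) \<and>
       \<phi> PSL2Z_b = \<sigma> \<and> \<phi> PSL2Z_c = \<tau>)"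

section \<open>The standard representation\<close>

text \<open>\<open>sym_group N\<close> acts on \<open>{1..N}\<close> while vector indices run over \<open>{0..<N}\<close>; the point
  \<open>Suc i\<close> corresponds to the coordinate \<open>i\<close>. A permutation \<open>p\<close> sends the basis vector
  of the point \<open>x\<close> to that of \<open>p x\<close>.\<close>

definition perm_rep :: "nat \<Rightarrow> (nat \<Rightarrow> nat) \<Rightarrow> complex mat" where
  "perm_rep N p = Matrix.mat N N (\<lambda>(i, j). if p (Suc j) = Suc i then 1 else 0)"

definition perm_invariants :: "nat \<Rightarrow> complex vec set" where
  "perm_invariants N =
     {v \<in> carrier_vec N. \<forall>p\<in>carrier (sym_group N). perm_rep N p *\<^sub>v v = v}"

definition std_space :: "nat \<Rightarrow> complex vec set" where
  "std_space N = {v \<in> carrier_vec N. \<forall>w\<in>perm_invariants N. v \<bullet>c w = 0}"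

definition orthonormal_basis :: "nat \<Rightarrow> complex vec set \<Rightarrow> complex vec list \<Rightarrow> bool" where
  "orthonormal_basis N V bs \<longleftrightarrow>
     set bs \<subseteq> carrier_vec N \<and>
     (\<forall>i<length bs. \<forall>j<length bs. bs ! i \<bullet>c bs ! j = (if i = j then 1 else 0)) \<and>
     LinearCombinations.module.span class_ring (module_vec TYPE(complex) N) (set bs) = V"

definition std_basis :: "nat \<Rightarrow> complex vec list" where
  "std_basis N = (SOME bs. orthonormal_basis N (std_space N) bs)"

text \<open>The matrix of the action on \<open>std_space N\<close> in a fixed orthonormal basis. The product
  \<open>\<bullet>c\<close> is linear in its first argument.\<close>

definition std_rep :: "nat \<Rightarrow> (nat \<Rightarrow> nat) \<Rightarrow> complex mat" where
  "std_rep N p = Matrix.mat (N - 1) (N - 1)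
     (\<lambda>(i, j). (perm_rep N p *\<^sub>v (std_basis N ! j)) \<bullet>c (std_basis N ! i))"

definition mat_trace :: "'a :: comm_monoid_add mat \<Rightarrow> 'a" where
  "mat_trace A = (\<Sum>i<dim_row A. A $$ (i, i))"

text \<open>The normalisation is by \<open>6 * n\<close>, not by the dimension \<open>6 * n - 1\<close>.\<close>

definition tr_Pi ::
  "nat \<Rightarrow> int mat set \<Rightarrow> (nat \<Rightarrow> nat) \<times> (nat \<Rightarrow> nat) \<Rightarrow> complex" where
  "tr_Pi n \<gamma> \<omega> = 1 / of_nat (6 * n) * mat_trace (std_rep (6 * n) (Phi n \<omega> \<gamma>))"

section \<open>The left regular representation and the canonical trace\<close>

definition ell2 :: "('a, 'b) monoid_scheme \<Rightarrow> ('a \<Rightarrow> complex) set" where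
  "ell2 G = {f \<in> extensional (carrier G). (\<lambda>x. (cmod (f x))\<^sup>2) summable_on carrier G}"

definition ell2_inner ::
  "('a, 'b) monoid_scheme \<Rightarrow> ('a \<Rightarrow> complex) \<Rightarrow> ('a \<Rightarrow> complex) \<Rightarrow> complex" where
  "ell2_inner G f g = (\<Sum>\<^sub>\<infinity>x\<in>carrier G. cnj (f x) * g x)"

definition delta_one :: "('a, 'b) monoid_scheme \<Rightarrow> 'a \<Rightarrow> complex" where
  "delta_one G = (\<lambda>x\<in>carrier G. if x = \<one>\<^bsub>G\<^esub> then 1 else 0)"

definition left_regular ::
  "('a, 'b) monoid_scheme \<Rightarrow> 'a \<Rightarrow> ('a \<Rightarrow> complex) \<Rightarrow> ('a \<Rightarrow> complex)" where
  "left_regular G g = (\<lambda>f\<in>ell2 G. \<lambda>x\<in>carrier G. f (inv\<^bsub>G\<^esub> g \<otimes>\<^bsub>G\<^esub> x))"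

definition canonical_trace ::
  "('a, 'b) monoid_scheme \<Rightarrow> (('a \<Rightarrow> complex) \<Rightarrow> ('a \<Rightarrow> complex)) \<Rightarrow> complex" where
  "canonical_trace G \<phi> = ell2_inner G (delta_one G) (\<phi> (delta_one G))"

end

(* Read letter by letter, a word of length k in the two random permutations traces a path, and it
   suffices to expose the cycles that the path meets. By exchangeability an exposed value is either one
   of the boundedly many points seen before, each with probability 1 / (N - d), or a new point, with
   probability (N - v) / (N - d), where N = 6 n. Hence the probability that the path from 1 returns
   to 1 is F (1 / N) for a function F that depends on the word only, is holomorphic on a disc of
   radius of order 1 / k and is bounded there by 4 ^ k. The character of std is the number of fixed
   points minus 1, so the expectation is F (1 / N) - 1 / N, and Cauchy's estimates bound its Taylor
   remainders. At 0 only paths through new points contribute; for a nonempty reduced word they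
   never close up, so F 0 = 0. A ping-pong argument shows that nonempty reduced words are exactly
   the nontrivial elements of PSL(2,Z). *)

theory Submission
  imports Defs "HOL-Complex_Analysis.Complex_Analysis"
begin

section \<open>Reduced words in the free product of cyclic groups of orders 2 and 3\<close>

text \<open>The coefficients must not depend on \<open>N\<close>, so for each word one function has
  to serve all degrees at once. It is built backwards along the word, as an average over the next
  exposed value written in z = 1 / N. The denominators 1 - d z stay away from 0 on the disc of
  radius 1 / (4 L), where L bounds the number of points ever seen: the start and at most two per
  syllable. On this disc one exposure at most doubles the bound, and a syllable costs at most two
  exposures, whence the factor 4. The obstacle is that averages are meaningful over nonempty sets
  only. This confines the degrees to multiples of 6 and makes nonemptiness a premise that travels
  through the induction. The constant (18 m)^(18 m) leaves ample room: the estimate reached is (576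
  m)^m.\<close>

datatype syllable = Sb | Sc | Scc

fun reduced :: "syllable list \<Rightarrow> bool" where
  "reduced (x # y # w) \<longleftrightarrow> (x = Sb) \<noteq> (y = Sb) \<and> reduced (y # w)"
| "reduced w \<longleftrightarrow> True"

text \<open>Left multiplication by a syllable, carried out on normal forms: only the head can merge
  with it, inside the same cyclic factor. Hence \<open>reduce\<close> computes a normal
  form.\<close>

fun push :: "syllable \<Rightarrow> syllable list \<Rightarrow> syllable list" where
  "push Sb (Sb # w) = w"
| "push Sc (Sc # w) = Scc # w"
| "push Sc (Scc # w) = w"
| "push Scc (Sc # w) = w"
| "push Scc (Scc # w) = Sc # w"
| "push x w = x # w"

definition reduce :: "syllable list \<Rightarrow> syllable list" where
  "reduce w = foldr push w []"

fun inv_syllable :: "syllable \<Rightarrow> syllable" where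
  "inv_syllable Sb = Sb"
| "inv_syllable Sc = Scc"
| "inv_syllable Scc = Sc"

definition inv_word :: "syllable list \<Rightarrow> syllable list" where
  "inv_word w = rev (map inv_syllable w)"

lemma reduced_ConsD: "reduced (x # w) \<Longrightarrow> reduced w"
  by (cases w) auto

lemma reduced_push: "reduced w \<Longrightarrow> reduced (push x w)"
proof (induction x w rule: push.induct)
qed (auto dest: reduced_ConsD elim: reduced.elims)

lemma reduced_reduce: "reduced (reduce w)"
  unfolding reduce_def by (induction w) (auto intro: reduced_push)

lemma length_push: "length (push x w) \<le> Suc (length w)"
  by (induction x w rule: push.induct) auto

lemma length_reduce: "length (reduce w) \<le> length w"
proof (induction w)
  case (Cons x w)
  then show ?case
    using length_push[of x "reduce w"] by (simp add: reduce_def)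
qed (simp add: reduce_def)

text \<open>Paths apply the last letter of a word first, so \<open>expands_word\<close> receives
  reversed words. Being reduced is a symmetric condition on neighbouring letters, as the
  characterisation by indices shows.\<close>

lemma reduced_rev: "reduced (rev w) \<longleftrightarrow> reduced w"
proof -
  have iff: "reduced w \<longleftrightarrow> (\<forall>i. Suc i < length w \<longrightarrow> (w ! i = Sb) \<noteq> (w ! Suc i = Sb))" for w
  proof (induction w rule: reduced.induct)
    case (1 x y w)
    have "(\<forall>i. Suc i < length (x # y # w) \<longrightarrow> P i) \<longleftrightarrow>
        P 0 \<and> (\<forall>i. Suc i < length (y # w) \<longrightarrow> P (Suc i))" for P
      by (metis Suc_less_eq length_Cons not0_implies_Suc zero_less_Suc)
    then show ?case using 1 by simp
  qed auto
  have "reduced (rev w)" if "reduced w" for w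
    unfolding iff
  proof (intro allI impI)
    fix i assume i: "Suc i < length (rev w)"
    let ?j = "length w - Suc (Suc i)"
    have "Suc ?j < length w" "length w - Suc i = Suc ?j" using i by auto
    with that i show "(rev w ! i = Sb) \<noteq> (rev w ! Suc i = Sb)"
      unfolding iff by (metis Suc_lessD length_rev rev_nth)
  qed
  from this[of w] this[of "rev w"] show ?thesis by auto
qed

text \<open>Serves both PSL(2,Z) and the symmetric groups, so that one word can be evaluated on
  either side. Inverses of values come from the two relations, through
  \<open>inv_word\<close>.\<close>

locale order_2_3_monoid = monoid G for G (structure) +
  fixes s t
  assumes s_closed: "s \<in> carrier G" and t_closed: "t \<in> carrier G"
    and s_square: "s \<otimes> s = \<one>" and t_cube: "t \<otimes> (t \<otimes> t) = \<one>"
begin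

definition letter :: "syllable \<Rightarrow> 'a" where
  "letter x = (case x of Sb \<Rightarrow> s | Sc \<Rightarrow> t | Scc \<Rightarrow> t \<otimes> t)"

definition weval :: "syllable list \<Rightarrow> 'a" where
  "weval w = foldr (\<lambda>x g. letter x \<otimes> g) w \<one>"

lemma letter_simps [simp]: "letter Sb = s" "letter Sc = t" "letter Scc = t \<otimes> t"
  by (simp_all add: letter_def)

lemma letter_closed [simp]: "letter x \<in> carrier G"
  using s_closed t_closed by (cases x) auto

lemma weval_Nil [simp]: "weval [] = \<one>"
  and weval_Cons [simp]: "weval (x # w) = letter x \<otimes> weval w"
  by (simp_all add: weval_def)

lemma weval_closed [simp]: "weval w \<in> carrier G"
  by (induction w) auto

lemma weval_append: "weval (u @ v) = weval u \<otimes> weval v"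
  by (induction u) (auto simp: m_assoc)

lemma s_cancel: "g \<in> carrier G \<Longrightarrow> s \<otimes> (s \<otimes> g) = g"
  using s_square by (metis l_one m_assoc s_closed)

lemma t_cancel: "g \<in> carrier G \<Longrightarrow> t \<otimes> (t \<otimes> (t \<otimes> g)) = g"
  using t_cube by (metis l_one m_assoc m_closed t_closed)

lemma weval_push: "weval (push x w) = letter x \<otimes> weval w"
  using s_closed t_closed by (induction x w rule: push.induct) (simp_all add: m_assoc s_cancel t_cancel)

lemma weval_reduce: "weval (reduce w) = weval w"
  unfolding reduce_def by (induction w) (auto simp: weval_push)

lemma letter_inv_syllable: "g \<in> carrier G \<Longrightarrow> letter x \<otimes> (letter (inv_syllable x) \<otimes> g) = g"
  using s_closed t_closed by (cases x) (simp_all add: m_assoc s_cancel t_cancel)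

lemma weval_inv_word: "weval w \<otimes> weval (inv_word w) = \<one>"
proof (induction w)
  case (Cons x w)
  have "weval (x # w) \<otimes> weval (inv_word (x # w))
      = letter x \<otimes> ((weval w \<otimes> weval (inv_word w)) \<otimes> letter (inv_syllable x))"
    by (simp add: inv_word_def weval_append m_assoc)
  also have "\<dots> = \<one>"
    using letter_inv_syllable[of \<one> x] by (simp add: Cons.IH)
  finally show ?case .
qed (simp add: inv_word_def)

lemma weval_inv_word': "weval (inv_word w) \<otimes> weval w = \<one>"
proof -
  have "inv_syllable (inv_syllable x) = x" for x by (cases x) auto
  then have "inv_word (inv_word w) = w" by (simp add: inv_word_def rev_map comp_def)
  then show ?thesis using weval_inv_word[of "inv_word w"] by simp
qed

end

text \<open>This gives \<open>G\<close> the universal property of the free product.\<close>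

lemma weval_transfer:
  assumes "order_2_3_monoid G s t" and "order_2_3_monoid H s' t'"
    and faithful: "\<And>w. reduced w \<Longrightarrow> order_2_3_monoid.weval G s t w = \<one>\<^bsub>G\<^esub> \<Longrightarrow> w = []"
    and eq: "order_2_3_monoid.weval G s t u = order_2_3_monoid.weval G s t v"
  shows "order_2_3_monoid.weval H s' t' u = order_2_3_monoid.weval H s' t' v"
proof -
  interpret G: order_2_3_monoid G s t by fact
  interpret H: order_2_3_monoid H s' t' by fact
  \<comment> \<open>The quotient of the two words has trivial value in \<open>G\<close>, hence
    reduces to the empty word; this is a statement about words alone, so it carries over to
    \<open>H\<close>.\<close>
  have "G.weval (reduce (inv_word v @ u)) = \<one>\<^bsub>G\<^esub>"
    by (simp add: G.weval_reduce G.weval_append eq G.weval_inv_word')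
  then have "reduce (inv_word v @ u) = []"
    by (rule faithful[OF reduced_reduce])
  then have "H.weval (inv_word v) \<otimes>\<^bsub>H\<^esub> H.weval u = \<one>\<^bsub>H\<^esub>"
    by (metis H.weval_Nil H.weval_append H.weval_reduce)
  then have "H.weval v \<otimes>\<^bsub>H\<^esub> (H.weval (inv_word v) \<otimes>\<^bsub>H\<^esub> H.weval u) = H.weval v"
    by simp
  then show ?thesis
    by (metis H.l_one H.m_assoc H.weval_closed H.weval_inv_word)
qed

section \<open>The modular group as a free product\<close>

definition mat2 :: "int \<Rightarrow> int \<Rightarrow> int \<Rightarrow> int \<Rightarrow> int mat" where
  "mat2 a b c d = mat_of_rows_list 2 [[a, b], [c, d]]"

lemma mat2_index [simp]:
  "mat2 a b c d $$ (0, 0) = a" "mat2 a b c d $$ (0, Suc 0) = b"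
  "mat2 a b c d $$ (Suc 0, 0) = c" "mat2 a b c d $$ (Suc 0, Suc 0) = d"
  by (simp_all add: mat2_def mat_of_rows_list_def)

lemma mat2_carrier [simp]: "mat2 a b c d \<in> carrier_mat 2 2"
  by (rule carrier_matI) (simp_all add: mat2_def mat_of_rows_list_def)

lemma mat2_dim [simp]: "dim_row (mat2 a b c d) = 2" "dim_col (mat2 a b c d) = 2"
  by (simp_all add: mat2_def mat_of_rows_list_def)

lemma mat2_eqI:
  fixes A B :: "int mat"
  assumes "A \<in> carrier_mat 2 2" "B \<in> carrier_mat 2 2"
    and "A $$ (0, 0) = B $$ (0, 0)" "A $$ (0, Suc 0) = B $$ (0, Suc 0)"
    and "A $$ (Suc 0, 0) = B $$ (Suc 0, 0)" "A $$ (Suc 0, Suc 0) = B $$ (Suc 0, Suc 0)"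
  shows "A = B"
proof (rule eq_matI)
  fix i j assume "i < dim_row B" "j < dim_col B"
  then have "i = 0 \<or> i = Suc 0" "j = 0 \<or> j = Suc 0" using assms(2) by auto
  then show "A $$ (i, j) = B $$ (i, j)" using assms by auto
qed (use assms in auto)

lemma mat2_eta: "A \<in> carrier_mat 2 2 \<Longrightarrow>
    A = mat2 (A $$ (0, 0)) (A $$ (0, Suc 0)) (A $$ (Suc 0, 0)) (A $$ (Suc 0, Suc 0))"
  by (rule mat2_eqI) auto

lemma mat2_eq_iff: "mat2 a b c d = mat2 a' b' c' d' \<longleftrightarrow> a = a' \<and> b = b' \<and> c = c' \<and> d = d'"
  by (metis mat2_index)

lemma mat2_mult: "mat2 a b c d * mat2 a' b' c' d'
    = mat2 (a * a' + b * c') (a * b' + b * d') (c * a' + d * c') (c * b' + d * d')"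
  by (rule mat2_eqI) (auto simp: scalar_prod_def numeral_2_eq_2)

lemma mat2_uminus: "- mat2 a b c d = mat2 (- a) (- b) (- c) (- d)"
  by (rule mat2_eqI) auto

lemma mat2_one: "1\<^sub>m 2 = mat2 1 0 0 1"
  by (rule mat2_eqI) auto

lemma mat2_det: "Determinant.det (mat2 a b c d) = a * d - b * c"
proof -
  have "Determinant.det (mat2 a b c d) = (\<Sum>j<2. mat2 a b c d $$ (0, j) * cofactor (mat2 a b c d) 0 j)"
    by (rule laplace_expansion_row) auto
  also have "\<dots> = a * cofactor (mat2 a b c d) 0 0 + b * cofactor (mat2 a b c d) 0 (Suc 0)"
    by (simp add: numeral_2_eq_2)
  also have "cofactor (mat2 a b c d) 0 0 = d"
    by (simp add: cofactor_def mat_delete_def det_single)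
  also have "cofactor (mat2 a b c d) 0 (Suc 0) = - c"
    by (simp add: cofactor_def mat_delete_def det_single)
  finally show ?thesis by simp
qed

lemma mat2_in_SL2Z [simp]: "mat2 a b c d \<in> carrier SL2Z \<longleftrightarrow> a * d - b * c = 1"
  by (simp add: SL2Z_def mat2_det)

lemma SL2Z_cases:
  assumes "A \<in> carrier SL2Z"
  obtains a b c d where "A = mat2 a b c d" "a * d - b * c = 1"
proof -
  have "A \<in> carrier_mat 2 2" using assms by (simp add: SL2Z_def)
  from mat2_eta[OF this] show ?thesis
    using that assms mat2_in_SL2Z by metis
qed

lemma mult_SL2Z: "A \<otimes>\<^bsub>SL2Z\<^esub> B = A * B" and one_SL2Z: "\<one>\<^bsub>SL2Z\<^esub> = mat2 1 0 0 1"
  by (simp_all add: SL2Z_def mat2_one)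

lemma SL2Z_center_eq: "SL2Z_center = {mat2 1 0 0 1, mat2 (- 1) 0 0 (- 1)}"
  by (simp add: SL2Z_center_def mat2_one mat2_uminus)

lemma group_SL2Z: "group SL2Z"
proof (rule groupI)
  fix x assume "x \<in> carrier SL2Z"
  then obtain a b c d where x: "x = mat2 a b c d" "a * d - b * c = 1"
    by (rule SL2Z_cases)
  have "mat2 d (- b) (- c) a \<in> carrier SL2Z"
    using x by (simp add: algebra_simps)
  moreover have "mat2 d (- b) (- c) a \<otimes>\<^bsub>SL2Z\<^esub> x = \<one>\<^bsub>SL2Z\<^esub>"
    using x by (auto simp: mult_SL2Z one_SL2Z mat2_mult mat2_eq_iff algebra_simps)
  ultimately show "\<exists>y\<in>carrier SL2Z. y \<otimes>\<^bsub>SL2Z\<^esub> x = \<one>\<^bsub>SL2Z\<^esub>" by blast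
next
  fix x y assume "x \<in> carrier SL2Z" "y \<in> carrier SL2Z"
  then show "x \<otimes>\<^bsub>SL2Z\<^esub> y \<in> carrier SL2Z"
    by (auto simp: SL2Z_def Determinant.det_mult)
qed (auto simp: SL2Z_def)

lemma normal_SL2Z_center: "SL2Z_center \<lhd> SL2Z"
proof -
  interpret group SL2Z by (rule group_SL2Z)
  have one: "mat2 1 0 0 1 \<in> carrier SL2Z" and minus_one: "mat2 (- 1) 0 0 (- 1) \<in> carrier SL2Z"
    by simp_all
  have inv: "inv\<^bsub>SL2Z\<^esub> a = a" if "a \<in> SL2Z_center" for a
    by (rule inv_equality)
      (use that one minus_one in \<open>auto simp: SL2Z_center_eq mult_SL2Z one_SL2Z mat2_mult\<close>)
  have "subgroup SL2Z_center SL2Z"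
  proof (rule subgroupI)
    fix a b assume "a \<in> SL2Z_center" "b \<in> SL2Z_center"
    then show "a \<otimes>\<^bsub>SL2Z\<^esub> b \<in> SL2Z_center"
      by (auto simp: SL2Z_center_eq mult_SL2Z mat2_mult)
  qed (use one minus_one in \<open>auto simp: SL2Z_center_eq inv[unfolded SL2Z_center_eq]\<close>)
  then show ?thesis
  proof (rule normalI)
    show "\<forall>x\<in>carrier SL2Z. SL2Z_center #>\<^bsub>SL2Z\<^esub> x = x <#\<^bsub>SL2Z\<^esub> SL2Z_center"
      by (auto simp: r_coset_def l_coset_def SL2Z_center_eq mult_SL2Z mat2_mult elim!: SL2Z_cases)
  qed
qed


section \<open>Computing in the quotient by the centre\<close>

definition PSL2Z_proj :: "int mat \<Rightarrow> int mat set" where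
  "PSL2Z_proj A = SL2Z_center #>\<^bsub>SL2Z\<^esub> A"

lemma PSL2Z_proj_mat2: "PSL2Z_proj (mat2 a b c d) = {mat2 a b c d, mat2 (- a) (- b) (- c) (- d)}"
  by (simp add: PSL2Z_proj_def r_coset_def SL2Z_center_eq mult_SL2Z mat2_mult insert_commute)

lemma PSL2Z_proj_uminus: "PSL2Z_proj (mat2 (- a) (- b) (- c) (- d)) = PSL2Z_proj (mat2 a b c d)"
  by (simp add: PSL2Z_proj_mat2 insert_commute)

lemma PSL2Z_b_eq: "PSL2Z_b = PSL2Z_proj (mat2 0 1 (- 1) 0)"
  and PSL2Z_c_eq: "PSL2Z_c = PSL2Z_proj (mat2 0 1 (- 1) 1)"
  by (simp_all add: PSL2Z_b_def PSL2Z_c_def PSL2Z_proj_def mat2_def)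

lemma group_PSL2Z: "group PSL2Z"
  unfolding PSL2Z_def by (rule normal.factorgroup_is_group[OF normal_SL2Z_center])

lemma carrier_PSL2Z: "carrier PSL2Z = PSL2Z_proj ` carrier SL2Z"
  by (simp add: PSL2Z_def carrier_FactGroup PSL2Z_proj_def)

lemma one_PSL2Z: "\<one>\<^bsub>PSL2Z\<^esub> = PSL2Z_proj (mat2 1 0 0 1)"
  by (simp add: PSL2Z_def PSL2Z_proj_mat2 SL2Z_center_eq)

lemma mult_PSL2Z:
  "A \<in> carrier SL2Z \<Longrightarrow> B \<in> carrier SL2Z \<Longrightarrow>
    PSL2Z_proj A \<otimes>\<^bsub>PSL2Z\<^esub> PSL2Z_proj B = PSL2Z_proj (A * B)"
  unfolding PSL2Z_def PSL2Z_proj_def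
  by (simp add: normal.rcos_sum[OF normal_SL2Z_center] mult_SL2Z)

global_interpretation PSL2Z: order_2_3_monoid PSL2Z PSL2Z_b PSL2Z_c
  defines PSL2Z_eval = PSL2Z.weval
proof -
  interpret group PSL2Z by (rule group_PSL2Z)
  show "order_2_3_monoid PSL2Z PSL2Z_b PSL2Z_c"
  proof
    show "PSL2Z_b \<otimes>\<^bsub>PSL2Z\<^esub> PSL2Z_b = \<one>\<^bsub>PSL2Z\<^esub>"
      using PSL2Z_proj_uminus[of 1 0 0 1] by (simp add: PSL2Z_b_eq mult_PSL2Z one_PSL2Z mat2_mult)
    show "PSL2Z_c \<otimes>\<^bsub>PSL2Z\<^esub> (PSL2Z_c \<otimes>\<^bsub>PSL2Z\<^esub> PSL2Z_c) = \<one>\<^bsub>PSL2Z\<^esub>"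
      using PSL2Z_proj_uminus[of 1 0 0 1] by (simp add: PSL2Z_c_eq mult_PSL2Z one_PSL2Z mat2_mult)
  qed (auto simp: PSL2Z_b_eq PSL2Z_c_eq carrier_PSL2Z)
qed

lemma PSL2Z_letter:
  "PSL2Z.letter Sb = PSL2Z_proj (mat2 0 1 (- 1) 0)"
  "PSL2Z.letter Sc = PSL2Z_proj (mat2 0 1 (- 1) 1)"
  "PSL2Z.letter Scc = PSL2Z_proj (mat2 (- 1) 1 (- 1) 0)"
proof -
  show "PSL2Z.letter Scc = PSL2Z_proj (mat2 (- 1) 1 (- 1) 0)"
    unfolding PSL2Z.letter_simps by (simp add: PSL2Z_c_eq mult_PSL2Z mat2_mult)
qed (simp_all flip: PSL2Z_b_eq PSL2Z_c_eq)

declare PSL2Z.letter_simps [simp del]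

text \<open>Elements of PSL(2,Z) act on vectors only up to sign, so the matrices of
  \<open>PSL2Z_letter\<close> are fixed as representatives. Both quantities of the ping-pong
  argument, the sign of p q and |p| + |q|, ignore that choice.\<close>

fun syllable_action :: "syllable \<Rightarrow> int \<times> int \<Rightarrow> int \<times> int" where
  "syllable_action Sb (p, q) = (q, - p)"
| "syllable_action Sc (p, q) = (q, q - p)"
| "syllable_action Scc (p, q) = (q - p, - p)"

text \<open>One matrix represents both the class of the word and its action on vectors, so that
  ping-pong on vectors yields information on classes of matrices up to sign.\<close>

lemma PSL2Z_eval_matrix:
  "\<exists>a b c d. a * d - b * c = 1 \<and> PSL2Z_eval w = PSL2Z_proj (mat2 a b c d) \<and>
     (\<forall>p q. foldr syllable_action w (p, q) = (a * p + b * q, c * p + d * q))"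
proof (induction w)
  case Nil
  show ?case by (rule exI[of _ 1], rule exI[of _ 0], rule exI[of _ 0], rule exI[of _ 1])
      (simp add: one_PSL2Z)
next
  case (Cons x w)
  then obtain a b c d where *: "a * d - b * c = 1" "PSL2Z_eval w = PSL2Z_proj (mat2 a b c d)"
    "\<And>p q. foldr syllable_action w (p, q) = (a * p + b * q, c * p + d * q)" by blast
  obtain a' b' c' d' where x: "a' * d' - b' * c' = 1" "PSL2Z.letter x = PSL2Z_proj (mat2 a' b' c' d')"
    "\<And>p q. syllable_action x (p, q) = (a' * p + b' * q, c' * p + d' * q)"
  proof (cases x)
    case Sb
    then show ?thesis using that[of 0 0 1 "- 1"] by (simp add: PSL2Z_letter)
  next
    case Sc
    then show ?thesis using that[of 0 1 1 "- 1"] by (simp add: PSL2Z_letter)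
  next
    case Scc
    then show ?thesis using that[of "- 1" 0 1 "- 1"] by (simp add: PSL2Z_letter)
  qed
  show ?case
  proof (intro exI conjI)
    show "PSL2Z_eval (x # w) = PSL2Z_proj (mat2 (a' * a + b' * c) (a' * b + b' * d)
        (c' * a + d' * c) (c' * b + d' * d))"
      using * x by (simp add: mult_PSL2Z mat2_mult)
    have "(a' * a + b' * c) * (c' * b + d' * d) - (a' * b + b' * d) * (c' * a + d' * c)
        = (a' * d' - b' * c') * (a * d - b * c)" by (simp add: algebra_simps)
    then show "(a' * a + b' * c) * (c' * b + d' * d) - (a' * b + b' * d) * (c' * a + d' * c) = 1"
      using * x by simp
  qed (simp add: * x algebra_simps)
qed

text \<open>Ping-pong on the two pairs of opposite open quadrants: \<open>b\<close> swaps them, whereas \<open>c\<close> and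
  \<open>c\<^sup>2\<close> map the vectors with \<open>p q < 0\<close> into those with \<open>p q > 0\<close> and lengthen them.\<close>

lemma syllable_action_ping_pong:
  assumes "reduced w" "w \<noteq> []" "if last w = Sb then p * q > 0 else p * q < 0"
    and "foldr syllable_action w (p, q) = (p', q')"
  shows "(if hd w = Sb then p' * q' < 0 else p' * q' > 0) \<and> \<bar>p\<bar> + \<bar>q\<bar> \<le> \<bar>p'\<bar> + \<bar>q'\<bar> \<and>
    (set w \<noteq> {Sb} \<longrightarrow> \<bar>p\<bar> + \<bar>q\<bar> < \<bar>p'\<bar> + \<bar>q'\<bar>)"
  using assms
proof (induction w arbitrary: p' q')
  case (Cons x w)
  \<comment> \<open>When u' v' < 0, absolute values of differences add up: \<open>c\<close> sends
    |u'| + |v'| to |u'| + 2 |v'|, and \<open>c\<^sup>2\<close> sends it to 2 |u'| + |v'|.\<close>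
  have step: "(if x = Sb then v * u < 0 else v * u > 0) \<and>
      (if x = Sb then \<bar>u'\<bar> + \<bar>v'\<bar> = \<bar>u\<bar> + \<bar>v\<bar> else \<bar>u'\<bar> + \<bar>v'\<bar> < \<bar>u\<bar> + \<bar>v\<bar>)"
    if "if x = Sb then u' * v' > 0 else u' * v' < 0" "syllable_action x (u', v') = (u, v)"
    for u v u' v' :: int
    using that by (cases x) (auto simp: zero_less_mult_iff mult_less_0_iff)
  obtain u' v' where w: "foldr syllable_action w (p, q) = (u', v')" by fastforce
  with Cons.prems have x: "syllable_action x (u', v') = (p', q')" by simp
  show ?case
  proof (cases "w = []")
    case True
    then show ?thesis using step[OF _ x] w Cons.prems(3) by (auto simp: mult.commute split: if_splits)
  next
    case False
    then have hd: "hd w = Sb \<longleftrightarrow> x \<noteq> Sb"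
      using Cons.prems(1) by (cases w) auto
    note IH = Cons.IH[OF reduced_ConsD[OF Cons.prems(1)] False _ w]
    have "x = Sb \<Longrightarrow> set w \<noteq> {Sb}"
      using hd False hd_in_set by blast
    then show ?thesis
      using step[OF _ x] IH hd False Cons.prems(3) by (auto simp: mult.commute split: if_splits)
  qed
qed simp

text \<open>A trivial word acts as 1 or -1 and preserves |p| + |q|, which leaves only the letter
  \<open>b\<close>; but \<open>b\<close> changes the sign of p q, whereas 1 and -1 keep it.\<close>

lemma PSL2Z_eval_faithful:
  assumes "reduced w" "PSL2Z_eval w = \<one>\<^bsub>PSL2Z\<^esub>"
  shows "w = []"
proof (rule ccontr)
  assume w: "w \<noteq> []"
  obtain a b c d where *: "PSL2Z_eval w = PSL2Z_proj (mat2 a b c d)"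
     "\<And>p q. foldr syllable_action w (p, q) = (a * p + b * q, c * p + d * q)"
    using PSL2Z_eval_matrix[of w] by blast
  have "mat2 a b c d \<in> PSL2Z_eval w" by (simp add: * PSL2Z_proj_mat2)
  then have "mat2 a b c d \<in> {mat2 1 0 0 1, mat2 (- 1) 0 0 (- 1)}"
    by (simp add: assms(2) one_PSL2Z PSL2Z_proj_mat2)
  then have abcd: "b = 0" "c = 0" "a = 1 \<and> d = 1 \<or> a = -1 \<and> d = -1"
    by (auto simp: mat2_eq_iff)
  \<comment> \<open>The start (1, 1) or (-1, 1) lies in the quadrants required by the letter that
    acts first, which is \<open>last w\<close>.\<close>
  define p :: int where "p = (if last w = Sb then 1 else - 1)"
  note pp = syllable_action_ping_pong[OF assms(1) w, of p 1, OF _ *(2)]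
  have "set w = {Sb}" "if hd w = Sb then p < 0 else p > 0"
    using pp abcd by (auto simp: p_def split: if_splits)
  moreover have "hd w \<in> set w" "last w \<in> set w" using w by simp_all
  ultimately show False by (auto simp: p_def)
qed

text \<open>Euclid's algorithm on the first column: up to sign, \<open>c\<^sup>2 b\<close> and
  \<open>b c\<close> are the translations by 1 and -1, and the generator \<open>b\<close> exchanges
  the two rows.\<close>

lemma PSL2Z_eval_surj:
  assumes "\<gamma> \<in> carrier PSL2Z"
  obtains w where "PSL2Z_eval w = \<gamma>"
proof -
  define Gen where "Gen = {A \<in> carrier SL2Z. \<exists>w. PSL2Z_eval w = PSL2Z_proj A}"
  have GenI: "A \<in> Gen" if "A \<in> carrier SL2Z" "PSL2Z_eval w = PSL2Z_proj A" for A w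
    using that by (auto simp: Gen_def)
  have mult: "A * B \<in> Gen" if "A \<in> Gen" "B \<in> Gen" for A B
  proof -
    from that obtain u v where "PSL2Z_eval u = PSL2Z_proj A" "PSL2Z_eval v = PSL2Z_proj B"
      and AB: "A \<in> carrier SL2Z" "B \<in> carrier SL2Z"
      by (auto simp: Gen_def)
    then have "PSL2Z_eval (u @ v) = PSL2Z_proj (A * B)"
      by (simp add: PSL2Z.weval_append mult_PSL2Z)
    then show ?thesis
      using AB monoid.m_closed[OF group.is_monoid[OF group_SL2Z] AB] by (intro GenI) (simp_all add: mult_SL2Z)
  qed
  have b: "mat2 0 1 (- 1) 0 \<in> Gen"
    by (rule GenI[of _ "[Sb]"]) (auto simp: PSL2Z_letter mult_PSL2Z one_PSL2Z mat2_mult)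
  have T: "mat2 1 1 0 1 \<in> Gen"
    using PSL2Z_proj_uminus[of 1 1 0 1]
    by (intro GenI[of _ "[Scc, Sb]"]) (simp_all add: PSL2Z_letter mult_PSL2Z one_PSL2Z mat2_mult)
  have T': "mat2 1 (- 1) 0 1 \<in> Gen"
    using PSL2Z_proj_uminus[of 1 "- 1" 0 1]
    by (intro GenI[of _ "[Sb, Sc]"]) (simp_all add: PSL2Z_letter mult_PSL2Z one_PSL2Z mat2_mult)
  have minus: "mat2 (- a) (- b) (- c) (- d) \<in> Gen" if "mat2 a b c d \<in> Gen" for a b c d
    using that by (auto simp: Gen_def PSL2Z_proj_uminus)
  have one: "mat2 1 0 0 1 \<in> Gen"
    by (rule GenI[of _ "[]"]) (auto simp: one_PSL2Z)
  have T_pow: "mat2 1 k 0 1 \<in> Gen" for k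
  proof (induction k rule: int_induct[of _ 0])
    case (step1 i)
    show ?case using mult[OF T step1(2)] by (simp add: mat2_mult)
  next
    case (step2 i)
    show ?case using mult[OF T' step2(2)] by (simp add: mat2_mult)
  qed (rule one)
  have Gen: "mat2 a b c d \<in> Gen" if "a * d - b * c = 1" for a b c d
    using that
  proof (induction "nat \<bar>c\<bar>" arbitrary: a b c d rule: less_induct)
    case less
    show ?case
    proof (cases "c = 0")
      case True
      then have "a = 1 \<and> d = 1 \<or> a = - 1 \<and> d = - 1"
        using less.prems by (auto simp: zmult_eq_1_iff)
      then show ?thesis
        using T_pow[of b] minus[OF T_pow[of "- b"]] True by auto
    next
      case False
      define k where "k = a div c"
      define r where "r = a - k * c"
      have r: "\<bar>r\<bar> < \<bar>c\<bar>"
        using False by (simp add: r_def k_def minus_div_mult_eq_mod abs_mod_less)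
      \<comment> \<open>Subtracting k times the second row from the first and then applying the
        generator of order 2 puts - r in the lower left corner, where |r| < |c|.\<close>
      have "c * (- (b - k * d)) - d * (- r) = 1"
        using less.prems by (simp add: r_def algebra_simps)
      then have "mat2 c d (- r) (- (b - k * d)) \<in> Gen"
        using less.hyps[of "- r"] r by simp
      from mult[OF T_pow[of k] mult[OF b this]] have "mat2 (- a) (- b) (- c) (- d) \<in> Gen"
        by (simp add: mat2_mult r_def algebra_simps)
      from minus[OF this] show ?thesis by simp
    qed
  qed
  from assms obtain A where "A \<in> carrier SL2Z" "\<gamma> = PSL2Z_proj A"
    by (auto simp: carrier_PSL2Z)
  then have "A \<in> Gen" using Gen by (auto elim!: SL2Z_cases)
  then show ?thesis using that \<open>\<gamma> = _\<close> by (auto simp: Gen_def)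
qed

text \<open>A shortest word in the two generators is read as syllables \<open>Sb\<close> and
  \<open>Sc\<close>, and reduction cannot lengthen it; \<open>c\<^sup>2\<close> shrinks from two
  letters to one syllable. Surjectivity enters because \<open>LEAST\<close> is informative only once
  some word exists.\<close>

lemma reduced_word_of_word_length:
  assumes "\<gamma> \<in> carrier PSL2Z"
  obtains w where "reduced w" "PSL2Z_eval w = \<gamma>"
    "length w \<le> word_length PSL2Z {PSL2Z_b, PSL2Z_c} \<gamma>"
proof -
  let ?P = "\<lambda>k. \<exists>l. length l = k \<and> set l \<subseteq> {PSL2Z_b, PSL2Z_c} \<and> foldr (\<otimes>\<^bsub>PSL2Z\<^esub>) l \<one>\<^bsub>PSL2Z\<^esub> = \<gamma>"
  have "\<exists>l. set l \<subseteq> {PSL2Z_b, PSL2Z_c} \<and> foldr (\<otimes>\<^bsub>PSL2Z\<^esub>) l \<one>\<^bsub>PSL2Z\<^esub> = PSL2Z_eval w" for w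
  proof (induction w)
    case (Cons x w)
    then obtain l where l: "set l \<subseteq> {PSL2Z_b, PSL2Z_c}" "foldr (\<otimes>\<^bsub>PSL2Z\<^esub>) l \<one>\<^bsub>PSL2Z\<^esub> = PSL2Z_eval w"
      by blast
    let ?l = "(case x of Sb \<Rightarrow> [PSL2Z_b] | Sc \<Rightarrow> [PSL2Z_c] | Scc \<Rightarrow> [PSL2Z_c, PSL2Z_c]) @ l"
    show ?case
      using l PSL2Z.s_closed PSL2Z.t_closed
      by (intro exI[of _ ?l]) (auto simp: PSL2Z.letter_simps PSL2Z.m_assoc split: syllable.split)
  qed (auto intro: exI[of _ "[]"])
  then have "\<exists>k. ?P k" using PSL2Z_eval_surj[OF assms] by metis
  then have "?P (word_length PSL2Z {PSL2Z_b, PSL2Z_c} \<gamma>)"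
    unfolding word_length_def by (rule LeastI_ex)
  then obtain l where l: "length l = word_length PSL2Z {PSL2Z_b, PSL2Z_c} \<gamma>"
    "set l \<subseteq> {PSL2Z_b, PSL2Z_c}" "foldr (\<otimes>\<^bsub>PSL2Z\<^esub>) l \<one>\<^bsub>PSL2Z\<^esub> = \<gamma>" by blast
  define w where "w = map (\<lambda>g. if g = PSL2Z_b then Sb else Sc) l"
  have "PSL2Z_eval w = foldr (\<otimes>\<^bsub>PSL2Z\<^esub>) l \<one>\<^bsub>PSL2Z\<^esub>"
    unfolding w_def using l(2) by (induction l) (auto simp: PSL2Z.letter_simps)
  then show ?thesis
    using that[of "reduce w"] l length_reduce[of w]
    by (simp add: reduced_reduce PSL2Z.weval_reduce w_def)
qed

text \<open>The description by \<open>THE\<close> needs existence and uniqueness. Evaluating any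
  word of an element is well defined by faithfulness of reduced words, and two homomorphisms
  agreeing on the generators agree on all words, hence on the whole group.\<close>

lemma Phi_eval:
  assumes "order_2_3_monoid (sym_group (6 * n)) \<sigma> \<tau>"
  shows "Phi n (\<sigma>, \<tau>) (PSL2Z_eval w) = order_2_3_monoid.weval (sym_group (6 * n)) \<sigma> \<tau> w"
proof -
  let ?S = "sym_group (6 * n)"
  interpret S: order_2_3_monoid ?S \<sigma> \<tau> by fact
  have transfer: "PSL2Z_eval u = PSL2Z_eval v \<Longrightarrow> S.weval u = S.weval v" for u v
    using weval_transfer[OF PSL2Z.order_2_3_monoid_axioms assms, folded PSL2Z_eval_def] PSL2Z_eval_faithful
    by blast
  define \<phi> where "\<phi> = (\<lambda>\<gamma>\<in>carrier PSL2Z. S.weval (SOME w. PSL2Z_eval w = \<gamma>))"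
  have \<phi>_eval: "\<phi> (PSL2Z_eval w) = S.weval w" for w
    unfolding \<phi>_def by (simp, rule transfer) (rule someI, rule refl)
  have "Phi n (\<sigma>, \<tau>) = \<phi>"
    unfolding Phi_def prod.case
  proof (rule the_equality)
    show "\<phi> \<in> hom PSL2Z ?S \<inter> extensional (carrier PSL2Z) \<and> \<phi> PSL2Z_b = \<sigma> \<and> \<phi> PSL2Z_c = \<tau>"
    proof (intro conjI IntI homI)
      fix x y assume "x \<in> carrier PSL2Z" "y \<in> carrier PSL2Z"
      then obtain u v where "PSL2Z_eval u = x" "PSL2Z_eval v = y"
        using PSL2Z_eval_surj by metis
      then show "\<phi> (x \<otimes>\<^bsub>PSL2Z\<^esub> y) = \<phi> x \<otimes>\<^bsub>?S\<^esub> \<phi> y"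
        by (metis PSL2Z.weval_append S.weval_append \<phi>_eval)
    next
      show "\<phi> PSL2Z_b = \<sigma>" "\<phi> PSL2Z_c = \<tau>"
        using \<phi>_eval[of "[Sb]"] \<phi>_eval[of "[Sc]"] PSL2Z.s_closed PSL2Z.t_closed S.s_closed S.t_closed
        by (simp_all add: PSL2Z.letter_simps)
    qed (auto simp: \<phi>_def)
  next
    fix \<psi> assume \<psi>: "\<psi> \<in> hom PSL2Z ?S \<inter> extensional (carrier PSL2Z) \<and> \<psi> PSL2Z_b = \<sigma> \<and> \<psi> PSL2Z_c = \<tau>"
    then have hom: "\<psi> (x \<otimes>\<^bsub>PSL2Z\<^esub> y) = \<psi> x \<otimes>\<^bsub>?S\<^esub> \<psi> y" if "x \<in> carrier PSL2Z" "y \<in> carrier PSL2Z" for x y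
      using that by (auto simp: hom_mult)
    have one: "\<psi> \<one>\<^bsub>PSL2Z\<^esub> = \<one>\<^bsub>?S\<^esub>"
      using \<psi> group_PSL2Z sym_group_is_group by (auto intro: hom_one)
    have "\<psi> (PSL2Z_eval w) = S.weval w" for w
    proof (induction w)
      case (Cons x w)
      have "\<psi> (PSL2Z.letter x) = S.letter x"
        using \<psi> by (cases x) (simp_all add: PSL2Z.letter_simps hom PSL2Z.t_closed)
      then show ?case by (simp add: hom Cons)
    qed (simp add: one)
    then show "\<psi> = \<phi>"
      using \<psi> PSL2Z_eval_surj \<phi>_eval by (intro extensionalityI[of _ "carrier PSL2Z"]) (auto simp: \<phi>_def, metis)
  qed
  then show ?thesis by (simp add: \<phi>_eval)
qed

section \<open>The character of the standard representation\<close>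

lemma perm_rep_mult_index:
  assumes "p permutes {1..N}" "v \<in> carrier_vec N" "j < N" "p (Suc j) = Suc i" "i < N"
  shows "vec_index (perm_rep N p *\<^sub>v v) i = vec_index v j"
proof -
  have inj: "p (Suc k) = Suc i \<longleftrightarrow> k = j" for k
    using permutes_inj[OF assms(1)] assms(4) by (metis injD nat.inject)
  have "vec_index (perm_rep N p *\<^sub>v v) i = (\<Sum>k = 0..<N. (if k = j then 1 else 0) * vec_index v k)"
    using assms(2,5) by (simp add: perm_rep_def scalar_prod_def inj)
  also have "\<dots> = vec_index v j"
    using assms(3) by (simp add: if_distrib[of "\<lambda>x. x * _"] cong: if_cong)
  finally show ?thesis .
qed

lemma perm_invariants_eq:
  "perm_invariants N = {v \<in> carrier_vec N. \<exists>c. \<forall>i<N. vec_index v i = c}"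
proof (intro equalityI subsetI)
  fix v assume v: "v \<in> perm_invariants N"
  have "vec_index v i = vec_index v 0" if i: "i < N" for i
  proof -
    \<comment> \<open>Invariance under the transposition of the points 1 and i + 1 equates the
      coordinates 0 and i.\<close>
    let ?p = "Transposition.transpose 1 (Suc i)"
    have p: "?p permutes {1..N}" using i by (intro permutes_swap_id) auto
    then have "perm_rep N ?p *\<^sub>v v = v"
      using v by (simp add: perm_invariants_def sym_group_carrier)
    then show "vec_index v i = vec_index v 0"
      using perm_rep_mult_index[OF p _, of v 0 i] v i by (simp add: perm_invariants_def)
  qed
  then have "\<exists>c. \<forall>i<N. vec_index v i = c" by blast
  then show "v \<in> {v \<in> carrier_vec N. \<exists>c. \<forall>i<N. vec_index v i = c}"
    using v by (simp add: perm_invariants_def)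
next
  fix v :: "complex vec"
  assume v: "v \<in> {v \<in> carrier_vec N. \<exists>c. \<forall>i<N. vec_index v i = c}"
  have "perm_rep N p *\<^sub>v v = v" if p: "p permutes {1..N}" for p
  proof (rule eq_vecI)
    fix i assume "i < dim_vec v"
    then have i: "i < N" using v by auto
    then have "Suc i \<in> p ` {1..N}" using permutes_image[OF p] by simp
    then obtain m where m: "m \<in> {1..N}" "p m = Suc i" by (metis imageE)
    then show "vec_index (perm_rep N p *\<^sub>v v) i = vec_index v i"
      using perm_rep_mult_index[OF p, of v "m - 1" i] v i m by force
  qed (use v in \<open>auto simp: perm_rep_def\<close>)
  then show "v \<in> perm_invariants N"
    using v by (simp add: perm_invariants_def sym_group_carrier)
qed

section \<open>The standard space in coordinates and its orthonormal bases\<close>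

lemma cscalar_prod_eq:
  "v \<in> carrier_vec N \<Longrightarrow> w \<in> carrier_vec N \<Longrightarrow>
    v \<bullet>c w = (\<Sum>i<N. vec_index v i * cnj (vec_index w i))"
  by (simp add: scalar_prod_def atLeast0LessThan)

lemma std_space_eq: "std_space N = {v \<in> carrier_vec N. (\<Sum>i<N. vec_index v i) = 0}"
proof -
  have "(\<forall>w\<in>perm_invariants N. v \<bullet>c w = 0) \<longleftrightarrow> (\<Sum>i<N. vec_index v i) = 0"
    if v: "v \<in> carrier_vec N" for v
  proof
    have one: "vec N (\<lambda>i. 1) \<in> perm_invariants N"
      by (auto simp: perm_invariants_eq)
    assume "\<forall>w\<in>perm_invariants N. v \<bullet>c w = 0"
    with one have "v \<bullet>c vec N (\<lambda>i. 1) = 0" by blast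
    then show "(\<Sum>i<N. vec_index v i) = 0"
      by (subst (asm) cscalar_prod_eq[OF v]) auto
  next
    assume *: "(\<Sum>i<N. vec_index v i) = 0"
    show "\<forall>w\<in>perm_invariants N. v \<bullet>c w = 0"
    proof
      fix w assume "w \<in> perm_invariants N"
      then obtain c where w: "w \<in> carrier_vec N" "\<And>i. i < N \<Longrightarrow> vec_index w i = c"
        by (auto simp: perm_invariants_eq)
      have "v \<bullet>c w = (\<Sum>i<N. vec_index v i * cnj c)"
        unfolding cscalar_prod_eq[OF v w(1)] by (intro sum.cong) (simp_all add: w(2))
      also have "\<dots> = 0" using * by (simp flip: sum_distrib_right)
      finally show "v \<bullet>c w = 0" .
    qed
  qed
  then show ?thesis unfolding std_space_def by blast
qed

text \<open>Membership in the span becomes a statement about coordinates, so that the following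
  proofs only exchange finite sums.\<close>

lemma in_span_iff:
  fixes bs :: "complex vec list"
  assumes "set bs \<subseteq> carrier_vec N"
  shows "v \<in> LinearCombinations.module.span class_ring (module_vec TYPE(complex) N) (set bs) \<longleftrightarrow>
    v \<in> carrier_vec N \<and> (\<exists>c. \<forall>k<N. vec_index v k = (\<Sum>j<length bs. vec_index (bs ! j) k * c j))"
proof -
  interpret vec_space "TYPE(complex)" N .
  have "lincomb_list c bs = mat_of_cols N bs *\<^sub>v vec (length bs) c" for c
    using assms by (intro lincomb_list_as_mat_mult) auto
  then have "v \<in> span (set bs) \<longleftrightarrow> (\<exists>c. v = mat_of_cols N bs *\<^sub>v vec (length bs) c)"
    unfolding span_list_as_span[OF assms, symmetric] span_list_def by simp
  also have "\<dots> \<longleftrightarrow> (\<exists>c. v \<in> carrier_vec N \<and>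
      (\<forall>k<N. vec_index v k = (\<Sum>j<length bs. vec_index (bs ! j) k * c j)))"
  proof (rule iff_exI)
    fix c
    let ?w = "mat_of_cols N bs *\<^sub>v vec (length bs) c"
    have index: "vec_index ?w k = (\<Sum>j<length bs. vec_index (bs ! j) k * c j)" if "k < N" for k
      using that by (simp add: scalar_prod_def atLeast0LessThan mat_of_cols_index)
    have "v = ?w \<longleftrightarrow> v \<in> carrier_vec N \<and> (\<forall>k<N. vec_index v k = vec_index ?w k)"
    proof
      assume *: "v \<in> carrier_vec N \<and> (\<forall>k<N. vec_index v k = vec_index ?w k)"
      show "v = ?w"
      proof (rule eq_vecI)
        fix k assume "k < dim_vec ?w"
        then have "k < N" by simp
        with * show "vec_index v k = vec_index ?w k" by blast
      qed (use * in auto)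
    qed (auto intro: carrier_vecI)
    also have "\<dots> \<longleftrightarrow> v \<in> carrier_vec N \<and>
        (\<forall>k<N. vec_index v k = (\<Sum>j<length bs. vec_index (bs ! j) k * c j))"
      using index by metis
    finally show "v = ?w \<longleftrightarrow> v \<in> carrier_vec N \<and>
        (\<forall>k<N. vec_index v k = (\<Sum>j<length bs. vec_index (bs ! j) k * c j))" .
  qed
  finally show ?thesis by blast
qed

text \<open>The sum of b b^H over the basis is the orthogonal projection onto the space, which is 1
  - J / N with J the all-ones matrix. The vector \<open>e\<close> is the projection of the i-th unit
  vector; pairing it with the basis, whose members have coordinate sum 0, gives its
  coefficients.\<close>

lemma orthonormal_basis_completeness:
  assumes onb: "orthonormal_basis N (std_space N) bs" and i: "i < N" and k: "k < N"
  shows "(\<Sum>j<length bs. vec_index (bs ! j) k * cnj (vec_index (bs ! j) i)) = of_bool (i = k) - 1 / of_nat N"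
proof -
  have bs: "set bs \<subseteq> carrier_vec N"
    and on: "\<And>i j. i < length bs \<Longrightarrow> j < length bs \<Longrightarrow> bs ! i \<bullet>c bs ! j = (if i = j then 1 else 0)"
    and span: "LinearCombinations.module.span class_ring (module_vec TYPE(complex) N) (set bs) = std_space N"
    using onb by (auto simp: orthonormal_basis_def)
  define e where "e = vec N (\<lambda>k. of_bool (i = k) - 1 / of_nat N :: complex)"
  have "e \<in> std_space N"
    using i by (auto simp: e_def std_space_eq sum_subtractf of_bool_def)
  then obtain c where c: "\<And>k. k < N \<Longrightarrow> vec_index e k = (\<Sum>j<length bs. vec_index (bs ! j) k * c j)"
    using in_span_iff[OF bs, of e] span by auto
  have c_eq: "c j = cnj (vec_index (bs ! j) i)" if j: "j < length bs" for j
  proof -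
    have carr: "bs ! l \<in> carrier_vec N" if "l < length bs" for l using bs that by auto
    have e: "e \<in> carrier_vec N" by (simp add: e_def)
    have "bs ! j \<in> std_space N"
      unfolding span[symmetric] in_span_iff[OF bs] using carr[OF j] j
      by (auto intro!: exI[of _ "\<lambda>l. of_bool (l = j)"] simp: of_bool_def if_distrib[of "\<lambda>x. _ * x"] cong: if_cong)
    then have sum0: "(\<Sum>k<N. vec_index (bs ! j) k) = 0" by (simp add: std_space_eq)
    have "e \<bullet>c bs ! j = (\<Sum>k<N. (\<Sum>l<length bs. vec_index (bs ! l) k * c l) * cnj (vec_index (bs ! j) k))"
      unfolding cscalar_prod_eq[OF e carr[OF j]] by (intro sum.cong) (simp_all add: c)
    also have "\<dots> = (\<Sum>l<length bs. \<Sum>k<N. vec_index (bs ! l) k * c l * cnj (vec_index (bs ! j) k))"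
      unfolding sum_distrib_right by (rule sum.swap)
    also have "\<dots> = (\<Sum>l<length bs. c l * (bs ! l \<bullet>c bs ! j))"
      by (intro sum.cong) (simp_all add: cscalar_prod_eq[OF carr carr[OF j]] sum_distrib_left mult_ac)
    also have "\<dots> = (\<Sum>l<length bs. c l * (if l = j then 1 else 0))"
      by (intro sum.cong) (simp_all add: on j)
    also have "\<dots> = c j" using j by (simp add: if_distrib[of "\<lambda>x. _ * x"] cong: if_cong)
    finally have "c j = (\<Sum>k<N. (of_bool (i = k) - 1 / of_nat N) * cnj (vec_index (bs ! j) k))"
      unfolding cscalar_prod_eq[OF e carr[OF j]] by (simp add: e_def)
    also have "\<dots> = (\<Sum>k<N. of_bool (i = k) * cnj (vec_index (bs ! j) k)) - 1 / of_nat N * cnj (\<Sum>k<N. vec_index (bs ! j) k)"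
      by (simp add: left_diff_distrib sum_subtractf sum_distrib_left)
    also have "\<dots> = cnj (vec_index (bs ! j) i)"
      using i by (simp add: sum0 of_bool_def if_distrib[of "\<lambda>x. x * _"] cong: if_cong)
    finally show ?thesis .
  qed
  show ?thesis using c[OF k] k by (simp add: c_eq e_def)
qed

text \<open>The trace of the projection counts the basis vectors and also equals N (1 - 1 / N). Thus
  the N - 1 indices in \<open>std_rep\<close> exhaust whatever basis \<open>SOME\<close>
  selects.\<close>

lemma orthonormal_basis_length:
  assumes onb: "orthonormal_basis N (std_space N) bs" and N: "N \<ge> 1"
  shows "length bs = N - 1"
proof -
  have carr: "bs ! j \<in> carrier_vec N" if "j < length bs" for j
    using onb that by (auto simp: orthonormal_basis_def)
  have "of_nat (length bs) = (\<Sum>j<length bs. bs ! j \<bullet>c bs ! j)"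
    using onb by (simp add: orthonormal_basis_def)
  also have "\<dots> = (\<Sum>j<length bs. \<Sum>i<N. vec_index (bs ! j) i * cnj (vec_index (bs ! j) i))"
    by (intro sum.cong) (simp_all add: cscalar_prod_eq[OF carr carr])
  also have "\<dots> = (\<Sum>i<N. \<Sum>j<length bs. vec_index (bs ! j) i * cnj (vec_index (bs ! j) i))"
    by (rule sum.swap)
  also have "\<dots> = (\<Sum>i<N. 1 - 1 / of_nat N)"
    by (intro sum.cong) (simp_all add: orthonormal_basis_completeness[OF onb])
  also have "\<dots> = of_nat (N - 1)"
    using N by (simp add: right_diff_distrib)
  finally show ?thesis using of_nat_eq_iff by blast
qed

section \<open>Existence of an orthonormal basis, from roots of unity\<close>

lemma sum_cis_multiples:
  assumes "d \<noteq> 0" "\<bar>d\<bar> < int N"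
  shows "(\<Sum>k<N. cis (2 * pi * (of_int d * of_nat k / of_nat N))) = 0"
proof -
  define z where "z = cis (2 * pi * of_int d / of_nat N)"
  have N: "N > 0" using assms by linarith
  have pow: "cis (2 * pi * (of_int d * of_nat k / of_nat N)) = z ^ k" for k
    unfolding z_def Complex.DeMoivre by (simp add: mult_ac)
  have "z ^ N = 1"
    using N cis_multiple_2pi[of "of_int d"] by (simp flip: pow)
  moreover have "z \<noteq> 1"
  proof
    assume "z = 1"
    then obtain m :: int where "Im (\<i> * complex_of_real (2 * pi * of_int d / of_nat N)) = of_int (2 * m) * pi"
      unfolding z_def cis_conv_exp exp_eq_1 by blast
    then have "real_of_int d = of_int m * of_nat N" using N by (simp add: field_simps)
    then have "d = m * int N" by (metis of_int_eq_iff of_int_mult of_int_of_nat_eq)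
    then show False using dvd_imp_le_int[OF assms(1), of "int N"] assms(2) by simp
  qed
  ultimately show ?thesis
    unfolding pow using geometric_sum[of z N] by simp
qed


lemma sum_cis_index:
  assumes "i < N" "k < N"
  shows "(\<Sum>j<N. cis (2 * pi * (of_nat j * (of_nat k - of_nat i) / of_nat N))) = (if i = k then of_nat N else 0)"
proof (cases "i = k")
  case False
  then show ?thesis
    using sum_cis_multiples[of "int k - int i" N] assms by (simp add: mult_ac)
qed simp

text \<open>Normalised characters of Z/N; \<open>Suc j\<close> skips the constant one, which spans
  the invariants. They witness the existence demanded by the \<open>SOME\<close> in
  \<open>std_basis\<close>.\<close>

definition fourier_basis :: "nat \<Rightarrow> complex vec list" where
  "fourier_basis N = map (\<lambda>j. vec N (\<lambda>k. cis (2 * pi * (of_nat (Suc j) * of_nat k / of_nat N)) / of_real (sqrt N))) [0..<N - 1]"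

lemma orthonormal_basis_fourier:
  assumes N: "N \<ge> 1"
  shows "orthonormal_basis N (std_space N) (fourier_basis N)"
proof -
  let ?b = "\<lambda>j k. cis (2 * pi * (of_nat j * of_nat k / of_nat N)) / complex_of_real (sqrt N)"
  let ?F = "fourier_basis N"
  have len: "length ?F = N - 1" by (simp add: fourier_basis_def)
  have nth: "?F ! j \<in> carrier_vec N" "\<And>k. k < N \<Longrightarrow> vec_index (?F ! j) k = ?b (Suc j) k"
    if "j < N - 1" for j
    using that by (simp_all add: fourier_basis_def)
  have carr: "set ?F \<subseteq> carrier_vec N" by (auto simp: fourier_basis_def)
  have sqrt: "complex_of_real (sqrt N) * complex_of_real (sqrt N) = of_nat N"
    by (simp flip: of_real_mult)
  have prod: "?b j k * cnj (?b l i) = cis (2 * pi * ((of_nat j * of_nat k - of_nat l * of_nat i) / of_nat N)) / of_nat N"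
    for j k l i
    by (simp add: cis_cnj sqrt cis_mult diff_divide_distrib right_diff_distrib)
  have orth: "?F ! i \<bullet>c ?F ! j = (if i = j then 1 else 0)" if ij: "i < N - 1" "j < N - 1" for i j
  proof -
    have "?F ! i \<bullet>c ?F ! j = (\<Sum>k<N. cis (2 * pi * (of_nat k * (of_nat (Suc i) - of_nat (Suc j)) / of_nat N)) / of_nat N)"
      unfolding cscalar_prod_eq[OF nth(1)[OF ij(1)] nth(1)[OF ij(2)]]
    proof (intro sum.cong refl)
      fix k assume "k \<in> {..<N}"
      then have k: "k < N" by simp
      show "vec_index (?F ! i) k * cnj (vec_index (?F ! j) k)
          = cis (2 * pi * (of_nat k * (of_nat (Suc i) - of_nat (Suc j)) / of_nat N)) / of_nat N"
        unfolding nth(2)[OF ij(1) k] nth(2)[OF ij(2) k] prod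
        by (simp add: algebra_simps del: of_nat_Suc)
    qed
    also have "\<dots> = (if i = j then 1 else 0)"
      unfolding sum_divide_distrib[symmetric] using ij N by (subst sum_cis_index) auto
    finally show ?thesis .
  qed
  have complete: "(\<Sum>j<N - 1. ?b (Suc j) k * cnj (?b (Suc j) i)) = of_bool (i = k) - 1 / of_nat N"
    if "i < N" "k < N" for i k
  proof -
    \<comment> \<open>All N characters together resolve the identity; splitting off the constant one
      accounts for the term 1 / N.\<close>
    have "(\<Sum>j<N. ?b j k * cnj (?b j i)) = of_bool (i = k)"
      unfolding prod using sum_cis_index[OF that] N
      by (simp add: right_diff_distrib flip: sum_divide_distrib)
    moreover have "(\<Sum>j<N. ?b j k * cnj (?b j i)) = ?b 0 k * cnj (?b 0 i) + (\<Sum>j<N - 1. ?b (Suc j) k * cnj (?b (Suc j) i))"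
      using sum.lessThan_Suc_shift[of "\<lambda>j. ?b j k * cnj (?b j i)" "N - 1"] N by (simp del: of_nat_Suc)
    moreover have "?b 0 k * cnj (?b 0 i) = 1 / of_nat N" by (simp add: sqrt)
    ultimately show ?thesis by (simp add: algebra_simps)
  qed
  have "LinearCombinations.module.span class_ring (module_vec TYPE(complex) N) (set ?F) = std_space N"
  proof (intro equalityI subsetI)
    fix v assume "v \<in> LinearCombinations.module.span class_ring (module_vec TYPE(complex) N) (set ?F)"
    then obtain c where v: "v \<in> carrier_vec N" "\<And>k. k < N \<Longrightarrow> vec_index v k = (\<Sum>j<N - 1. ?b (Suc j) k * c j)"
      unfolding in_span_iff[OF carr] by (auto simp: len nth simp del: of_nat_Suc)
    have "(\<Sum>k<N. vec_index v k) = (\<Sum>k<N. \<Sum>j<N - 1. ?b (Suc j) k * c j)"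
      by (intro sum.cong) (simp_all add: v)
    also have "\<dots> = (\<Sum>j<N - 1. (\<Sum>k<N. ?b (Suc j) k) * c j)"
      unfolding sum_distrib_right by (rule sum.swap)
    also have "\<dots> = 0"
    proof (intro sum.neutral ballI)
      fix j assume "j \<in> {..<N - 1}"
      then show "(\<Sum>k<N. ?b (Suc j) k) * c j = 0"
        using sum_cis_multiples[of "int (Suc j)" N] by (simp flip: sum_divide_distrib)
    qed
    finally show "v \<in> std_space N" using v by (simp add: std_space_eq)
  next
    fix v assume v: "v \<in> std_space N"
    let ?c = "\<lambda>j. \<Sum>i<N. cnj (?b (Suc j) i) * vec_index v i"
    have "vec_index v k = (\<Sum>j<length ?F. vec_index (?F ! j) k * ?c j)" if k: "k < N" for k
    proof -
      have "(\<Sum>j<length ?F. vec_index (?F ! j) k * ?c j) = (\<Sum>j<N - 1. \<Sum>i<N. ?b (Suc j) k * cnj (?b (Suc j) i) * vec_index v i)"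
        unfolding len by (intro sum.cong) (simp_all only: nth k lessThan_iff sum_distrib_left mult.assoc)
      also have "\<dots> = (\<Sum>i<N. (\<Sum>j<N - 1. ?b (Suc j) k * cnj (?b (Suc j) i)) * vec_index v i)"
        unfolding sum_distrib_right by (rule sum.swap)
      also have "\<dots> = (\<Sum>i<N. (of_bool (i = k) - 1 / of_nat N) * vec_index v i)"
        by (intro sum.cong) (simp_all only: complete k lessThan_iff)
      also have "\<dots> = vec_index v k - 1 / of_nat N * (\<Sum>i<N. vec_index v i)"
        using k by (simp add: left_diff_distrib sum_subtractf sum_distrib_left of_bool_def
            if_distrib[of "\<lambda>x. x * _"] cong: if_cong)
      also have "\<dots> = vec_index v k" using v by (simp add: std_space_eq)
      finally show ?thesis by simp
    qed
    then have "\<exists>c. \<forall>k<N. vec_index v k = (\<Sum>j<length ?F. vec_index (?F ! j) k * c j)"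
      by (intro exI[of _ ?c] allI impI)
    moreover have "v \<in> carrier_vec N" using v by (simp add: std_space_eq)
    ultimately show "v \<in> LinearCombinations.module.span class_ring (module_vec TYPE(complex) N) (set ?F)"
      unfolding in_span_iff[OF carr] by blast
  qed
  then show ?thesis
    unfolding orthonormal_basis_def len using carr orth by blast
qed

text \<open>By completeness the trace is that of P (1 - J / N), whatever basis was chosen: P
  contributes the fixed points, and P J / N contributes 1 because every row of P sums to 1.\<close>

lemma trace_std_rep:
  assumes N: "N \<ge> 1" and p: "p permutes {1..N}"
  shows "mat_trace (std_rep N p) = of_nat (card {x \<in> {1..N}. p x = x}) - 1"
proof -
  define bs where "bs = std_basis N"
  have onb: "orthonormal_basis N (std_space N) bs"
    unfolding bs_def std_basis_def using orthonormal_basis_fourier[OF N] by (rule someI)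
  have len: "length bs = N - 1" by (rule orthonormal_basis_length[OF onb N])
  have carr: "bs ! j \<in> carrier_vec N" if "j < N - 1" for j
    using onb that len by (auto simp: orthonormal_basis_def)
  define P where "P = (\<lambda>i k. if p (Suc k) = Suc i then 1 else 0 :: complex)"
  have P_mult: "vec_index (perm_rep N p *\<^sub>v bs ! j) i = (\<Sum>k<N. P i k * vec_index (bs ! j) k)"
    if "j < N - 1" "i < N" for i j
    using carr[OF that(1)] that by (simp add: perm_rep_def P_def scalar_prod_def atLeast0LessThan)
  have "mat_trace (std_rep N p) = (\<Sum>j<N - 1. (perm_rep N p *\<^sub>v bs ! j) \<bullet>c bs ! j)"
    by (simp add: mat_trace_def std_rep_def bs_def)
  also have "\<dots> = (\<Sum>j<N - 1. \<Sum>i<N. \<Sum>k<N. P i k * (vec_index (bs ! j) k * cnj (vec_index (bs ! j) i)))"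
  proof (intro sum.cong refl)
    fix j assume "j \<in> {..<N - 1}"
    then have j: "j < N - 1" by simp
    have dim: "perm_rep N p *\<^sub>v bs ! j \<in> carrier_vec N"
      by (rule mult_mat_vec_carrier[OF _ carr[OF j]]) (simp add: perm_rep_def)
    show "(perm_rep N p *\<^sub>v bs ! j) \<bullet>c bs ! j = (\<Sum>i<N. \<Sum>k<N. P i k * (vec_index (bs ! j) k * cnj (vec_index (bs ! j) i)))"
      unfolding cscalar_prod_eq[OF dim carr[OF j]]
      by (intro sum.cong refl) (simp only: P_mult[OF j] lessThan_iff sum_distrib_right mult.assoc)
  qed
  also have "\<dots> = (\<Sum>i<N. \<Sum>j<N - 1. \<Sum>k<N. P i k * (vec_index (bs ! j) k * cnj (vec_index (bs ! j) i)))"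
    by (rule sum.swap)
  also have "\<dots> = (\<Sum>i<N. \<Sum>k<N. P i k * (\<Sum>j<N - 1. vec_index (bs ! j) k * cnj (vec_index (bs ! j) i)))"
    by (rule sum.cong[OF refl], subst sum.swap) (simp only: sum_distrib_left)
  also have "\<dots> = (\<Sum>i<N. \<Sum>k<N. P i k * (of_bool (i = k) - 1 / of_nat N))"
    using orthonormal_basis_completeness[OF onb] by (intro sum.cong refl) (simp add: len)
  also have "\<dots> = (\<Sum>i<N. P i i - 1 / of_nat N)"
  proof (intro sum.cong refl)
    fix i assume "i \<in> {..<N}"
    then have i: "i < N" by simp
    then have "Suc i \<in> p ` {1..N}" using permutes_image[OF p] by simp
    then obtain l where "l \<in> {1..N}" "p l = Suc i" by (metis imageE)
    then obtain m where m: "m < N" "p (Suc m) = Suc i" by (cases l) (auto simp: Suc_le_eq)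
    then have "p (Suc k) = Suc i \<longleftrightarrow> k = m" for k
      using permutes_inj[OF p] by (metis injD nat.inject)
    then have "(\<Sum>k<N. P i k) = 1" using m by (simp add: P_def)
    then have "(\<Sum>k<N. P i k * (1 / of_nat N)) = 1 / of_nat N"
      by (simp flip: sum_divide_distrib)
    moreover have "(\<Sum>k<N. P i k * of_bool (i = k)) = P i i"
      using i by (simp add: of_bool_def if_distrib[of "\<lambda>x. _ * x"] cong: if_cong)
    ultimately show "(\<Sum>k<N. P i k * (of_bool (i = k) - 1 / of_nat N)) = P i i - 1 / of_nat N"
      by (simp add: right_diff_distrib sum_subtractf)
  qed
  also have "\<dots> = (\<Sum>i<N. P i i) - 1"
    using N by (simp add: sum_subtractf)
  also have "(\<Sum>i<N. P i i) = of_nat (card {i \<in> {..<N}. p (Suc i) = Suc i})"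
    by (simp add: P_def sum.If_cases Int_def)
  also have "card {i \<in> {..<N}. p (Suc i) = Suc i} = card (Suc ` {i \<in> {..<N}. p (Suc i) = Suc i})"
    by (simp add: card_image)
  also have "Suc ` {i \<in> {..<N}. p (Suc i) = Suc i} = {x \<in> {1..N}. p x = x}"
    by (auto simp: image_iff) (metis Suc_le_eq Suc_pred)
  finally show ?thesis .
qed

section \<open>Exposing the two random permutations step by step\<close>

text \<open>The two permutations of a pair are indexed by \<open>bool\<close>, the involution being indexed by
  \<open>True\<close>; \<open>C b\<close> is the part of the graph of the permutation \<open>b\<close> that has been exposed.\<close>

definition component :: "bool \<Rightarrow> 'a \<times> 'a \<Rightarrow> 'a" where
  "component b \<omega> = (if b then fst \<omega> else snd \<omega>)"

text \<open>Conditioning on exposed values is restriction to this set, which may be empty for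
  impossible data \<open>C\<close>. Orders are expressed by equations on points, the form in which
  exposed values are followed.\<close>

definition cycle_pairs :: "nat \<Rightarrow> (bool \<Rightarrow> (nat \<times> nat) set) \<Rightarrow> ((nat \<Rightarrow> nat) \<times> (nat \<Rightarrow> nat)) set" where
  "cycle_pairs N C = {\<omega>. (\<forall>b. component b \<omega> permutes {1..N} \<and> (\<forall>x\<in>{1..N}. component b \<omega> x \<noteq> x)) \<and>
     (\<forall>x\<in>{1..N}. fst \<omega> (fst \<omega> x) = x) \<and> (\<forall>x\<in>{1..N}. snd \<omega> (snd \<omega> (snd \<omega> x)) = x) \<and>
     (\<forall>b x y. (x, y) \<in> C b \<longrightarrow> component b \<omega> x = y)}"

fun move :: "(nat \<Rightarrow> nat) \<times> (nat \<Rightarrow> nat) \<Rightarrow> syllable \<Rightarrow> nat \<Rightarrow> nat" where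
  "move \<omega> Sb x = fst \<omega> x"
| "move \<omega> Sc x = snd \<omega> x"
| "move \<omega> Scc x = snd \<omega> (snd \<omega> x)"

text \<open>The conditional probability of \<open>P\<close> given \<open>A\<close>, by counting. On
  an empty \<open>A\<close> division by zero makes it 0, which is why nonemptiness accompanies the
  later statements.\<close>

definition ratio :: "'a set \<Rightarrow> ('a \<Rightarrow> bool) \<Rightarrow> real" where
  "ratio A P = real (card {\<omega> \<in> A. P \<omega>}) / real (card A)"

lemma component_simps [simp]: "component True \<omega> = fst \<omega>" "component False \<omega> = snd \<omega>"
  by (simp_all add: component_def)

lemma all_bool: "(\<forall>b. P b) \<longleftrightarrow> P True \<and> P False"
  by (metis (full_types))

section \<open>Conditioning on a uniformly distributed value\<close>

lemma finite_cycle_pairs: "finite (cycle_pairs N C)"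
proof (rule finite_subset)
  show "cycle_pairs N C \<subseteq> {p. p permutes {1..N}} \<times> {p. p permutes {1..N}}"
    by (auto simp: cycle_pairs_def all_bool)
qed (simp add: finite_permutations)

lemma ratio_cong: "A = B \<Longrightarrow> (\<And>\<omega>. \<omega> \<in> B \<Longrightarrow> P \<omega> \<longleftrightarrow> Q \<omega>) \<Longrightarrow> ratio A P = ratio B Q"
  unfolding ratio_def by (metis (mono_tags, lifting) Collect_cong)

lemma ratio_bij:
  assumes "bij_betw f A B" "\<And>\<omega>. \<omega> \<in> A \<Longrightarrow> Q (f \<omega>) \<longleftrightarrow> P \<omega>"
  shows "ratio A P = ratio B Q"
proof -
  have "f ` {\<omega> \<in> A. P \<omega>} = {\<omega> \<in> B. Q \<omega>}"
    using assms bij_betw_imp_surj_on[OF assms(1)] by blast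
  then have "bij_betw f {\<omega> \<in> A. P \<omega>} {\<omega> \<in> B. Q \<omega>}"
    by (intro bij_betw_subset[OF assms(1)]) auto
  then show ?thesis
    unfolding ratio_def using bij_betw_same_card assms(1) by (metis (no_types))
qed

text \<open>Passes nonemptiness on to the restriction by each admissible value, as the next exposure
  requires.\<close>

lemma uniform_fibre_nonempty:
  assumes "finite A" "A \<noteq> {}" "f ` A \<subseteq> T" "y \<in> T"
    and "\<And>y y'. y \<in> T \<Longrightarrow> y' \<in> T \<Longrightarrow> card {\<omega> \<in> A. f \<omega> = y} = card {\<omega> \<in> A. f \<omega> = y'}"
  shows "{\<omega> \<in> A. f \<omega> = y} \<noteq> {}"
proof -
  obtain \<omega> where \<omega>: "\<omega> \<in> A" using assms(2) by blast
  then have "{\<omega>' \<in> A. f \<omega>' = f \<omega>} \<noteq> {}" by blast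
  then have "card {\<omega>' \<in> A. f \<omega>' = f \<omega>} \<noteq> 0" using assms(1) by simp
  also have "card {\<omega>' \<in> A. f \<omega>' = f \<omega>} = card {\<omega> \<in> A. f \<omega> = y}"
    using assms \<omega> by blast
  finally show ?thesis by force
qed

text \<open>Total probability for \<open>f\<close> uniformly distributed on \<open>T\<close>: the
  fibres share one size k, so that \<open>A\<close> has card T * k elements.\<close>

lemma ratio_uniform_fibres:
  assumes "finite A" "A \<noteq> {}" "f ` A \<subseteq> T" "finite T"
    and eq: "\<And>y y'. y \<in> T \<Longrightarrow> y' \<in> T \<Longrightarrow> card {\<omega> \<in> A. f \<omega> = y} = card {\<omega> \<in> A. f \<omega> = y'}"
  shows "ratio A P = (\<Sum>y\<in>T. ratio {\<omega> \<in> A. f \<omega> = y} P) / real (card T)"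
proof -
  obtain t where t: "t \<in> T" using assms(2,3) by blast
  define k where "k = card {\<omega> \<in> A. f \<omega> = t}"
  have k: "card {\<omega> \<in> A. f \<omega> = y} = k" if "y \<in> T" for y
    unfolding k_def using eq that t by blast
  have count: "card {\<omega> \<in> A. Q \<omega>} = (\<Sum>y\<in>T. card {\<omega> \<in> {\<omega> \<in> A. f \<omega> = y}. Q \<omega>})" for Q
  proof -
    have "(\<Sum>y\<in>T. \<Sum>\<omega>\<in>{\<omega> \<in> {\<omega> \<in> A. Q \<omega>}. f \<omega> = y}. 1 :: nat) = (\<Sum>\<omega>\<in>{\<omega> \<in> A. Q \<omega>}. 1)"
      using assms by (intro sum.group) auto
    moreover have "{\<omega> \<in> {\<omega> \<in> A. Q \<omega>}. f \<omega> = y} = {\<omega> \<in> {\<omega> \<in> A. f \<omega> = y}. Q \<omega>}" for y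
      by blast
    ultimately show ?thesis by simp
  qed
  have A: "card A = card T * k" using count[of "\<lambda>_. True"] k by simp
  have "(\<Sum>y\<in>T. ratio {\<omega> \<in> A. f \<omega> = y} P) = (\<Sum>y\<in>T. real (card {\<omega> \<in> {\<omega> \<in> A. f \<omega> = y}. P \<omega>}) / real k)"
    by (intro sum.cong refl) (simp only: ratio_def k)
  also have "\<dots> = real (card {\<omega> \<in> A. P \<omega>}) / real k"
    by (simp only: count[of P] of_nat_sum sum_divide_distrib)
  finally show ?thesis by (simp add: ratio_def A mult.commute)
qed

subsection \<open>Exchangeability\<close>

text \<open>The conjugating maps are involutions where this is used, so no inverse is written. They
  may differ for the two permutations, since \<open>cycle_pairs\<close> imposes its conditions on
  each separately.\<close>

definition conj_pair :: "(bool \<Rightarrow> nat \<Rightarrow> nat) \<Rightarrow> (nat \<Rightarrow> nat) \<times> (nat \<Rightarrow> nat) \<Rightarrow> (nat \<Rightarrow> nat) \<times> (nat \<Rightarrow> nat)" where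
  "conj_pair \<pi> \<omega> = (\<pi> True \<circ> fst \<omega> \<circ> \<pi> True, \<pi> False \<circ> snd \<omega> \<circ> \<pi> False)"

definition relabel :: "(bool \<Rightarrow> nat \<Rightarrow> nat) \<Rightarrow> (bool \<Rightarrow> (nat \<times> nat) set) \<Rightarrow> bool \<Rightarrow> (nat \<times> nat) set" where
  "relabel \<pi> C b = map_prod (\<pi> b) (\<pi> b) ` C b"

lemma component_conj_pair: "component b (conj_pair \<pi> \<omega>) x = \<pi> b (component b \<omega> (\<pi> b x))"
  by (cases b) (simp_all add: conj_pair_def)

context
  fixes \<pi> :: "bool \<Rightarrow> nat \<Rightarrow> nat" and N :: nat
  assumes permutes: "\<And>b. \<pi> b permutes {1..N}" and invol: "\<And>b x. \<pi> b (\<pi> b x) = x"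
begin

lemma conj_pair_invol: "conj_pair \<pi> (conj_pair \<pi> \<omega>) = \<omega>"
  by (simp add: conj_pair_def fun_eq_iff invol prod_eq_iff)

lemma relabel_invol: "relabel \<pi> (relabel \<pi> C) = C"
  by (auto simp: relabel_def fun_eq_iff image_image map_prod_def invol split_def)

lemma conj_pair_mem:
  assumes "\<omega> \<in> cycle_pairs N C"
  shows "conj_pair \<pi> \<omega> \<in> cycle_pairs N (relabel \<pi> C)"
proof -
  have inv_eq: "\<pi> b x = y \<longleftrightarrow> x = \<pi> b y" for b x y using invol by metis
  have mem: "\<pi> b x \<in> {1..N} \<longleftrightarrow> x \<in> {1..N}" for b x
    using permutes_in_image[OF permutes] .
  have \<omega>: "component b \<omega> permutes {1..N}" "x \<in> {1..N} \<Longrightarrow> component b \<omega> x \<noteq> x"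
    "x \<in> {1..N} \<Longrightarrow> fst \<omega> (fst \<omega> x) = x" "x \<in> {1..N} \<Longrightarrow> snd \<omega> (snd \<omega> (snd \<omega> x)) = x"
    "(x, y) \<in> C b \<Longrightarrow> component b \<omega> x = y" for b x y
    using assms unfolding cycle_pairs_def by blast+
  have "component b (conj_pair \<pi> \<omega>) permutes {1..N}" for b
  proof -
    have "component b (conj_pair \<pi> \<omega>) = \<pi> b \<circ> (component b \<omega> \<circ> \<pi> b)"
      by (auto simp: component_conj_pair)
    then show ?thesis using \<omega>(1) permutes by (metis permutes_compose)
  qed
  moreover have "component b (conj_pair \<pi> \<omega>) x \<noteq> x" if "x \<in> {1..N}" for b x
    unfolding component_conj_pair inv_eq using \<omega>(2)[of "\<pi> b x" b] that mem by blast
  moreover have "fst (conj_pair \<pi> \<omega>) (fst (conj_pair \<pi> \<omega>) x) = x"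
    "snd (conj_pair \<pi> \<omega>) (snd (conj_pair \<pi> \<omega>) (snd (conj_pair \<pi> \<omega>) x)) = x" if "x \<in> {1..N}" for x
    using \<omega>(3)[of "\<pi> True x"] \<omega>(4)[of "\<pi> False x"] that
    unfolding mem by (simp_all add: conj_pair_def invol)
  moreover have "component b (conj_pair \<pi> \<omega>) x = y" if "(x, y) \<in> relabel \<pi> C b" for b x y
    using that \<omega>(5) by (auto simp: relabel_def component_conj_pair invol)
  ultimately show ?thesis by (simp add: cycle_pairs_def)
qed

lemma bij_betw_conj_pair:
  "bij_betw (conj_pair \<pi>) (cycle_pairs N C) (cycle_pairs N (relabel \<pi> C))"
proof (rule bij_betw_byWitness[of _ "conj_pair \<pi>"])
  show "conj_pair \<pi> ` cycle_pairs N (relabel \<pi> C) \<subseteq> cycle_pairs N C"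
    using conj_pair_mem[of _ "relabel \<pi> C"] by (auto simp: relabel_invol)
qed (auto simp: conj_pair_invol intro: conj_pair_mem)

end

lemma fold_move_conj_pair:
  assumes "\<And>x. \<pi> (\<pi> x) = x"
  shows "fold (move (conj_pair (\<lambda>_. \<pi>) \<omega>)) w (\<pi> x) = \<pi> (fold (move \<omega>) w x)"
proof (induction w arbitrary: x)
  case (Cons a w)
  have "move (conj_pair (\<lambda>_. \<pi>) \<omega>) a (\<pi> x) = \<pi> (move \<omega> a x)"
    by (cases a) (simp_all add: conj_pair_def assms)
  then show ?case by (simp add: Cons.IH)
qed simp

lemma transpose_image_id:
  assumes "a \<notin> Field R" "b \<notin> Field R"
  shows "map_prod (Transposition.transpose a b) (Transposition.transpose a b) ` R = R"
proof -
  have "map_prod (Transposition.transpose a b) (Transposition.transpose a b) e = id e" if "e \<in> R" for e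
    using that assms by (cases e) (auto simp: Transposition.transpose_def Field_def)
  then have "map_prod (Transposition.transpose a b) (Transposition.transpose a b) ` R = id ` R"
    by (rule image_cong[OF refl])
  then show ?thesis by simp
qed

text \<open>Both permutations are conjugated by the same transposition, which relabels the whole
  path; hence y and y' have to avoid both exposed parts as well as the points u, x and x0.\<close>

lemma ratio_exchange:
  assumes y: "y \<in> {1..N}" and y': "y' \<in> {1..N}"
    and fresh: "\<And>b. y \<notin> Field (C b)" "\<And>b. y' \<notin> Field (C b)" "y \<notin> {u, x, x0}" "y' \<notin> {u, x, x0}"
  shows "ratio (cycle_pairs N (C(s := insert (u, y) (C s)))) (\<lambda>\<omega>. fold (move \<omega>) w x = x0)
       = ratio (cycle_pairs N (C(s := insert (u, y') (C s)))) (\<lambda>\<omega>. fold (move \<omega>) w x = x0)"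
proof -
  let ?\<pi> = "Transposition.transpose y y'"
  have relabel: "relabel (\<lambda>_. ?\<pi>) (C(s := insert (u, y) (C s))) = C(s := insert (u, y') (C s))"
    using fresh by (auto simp: relabel_def fun_eq_iff transpose_image_id)
  have bij: "bij_betw (conj_pair (\<lambda>_. ?\<pi>)) (cycle_pairs N (C(s := insert (u, y) (C s))))
      (cycle_pairs N (C(s := insert (u, y') (C s))))"
    unfolding relabel[symmetric]
    by (rule bij_betw_conj_pair[OF permutes_swap_id[OF y y']]) simp
  show ?thesis
  proof (rule ratio_bij[OF bij])
    fix \<omega>
    have "fold (move (conj_pair (\<lambda>_. ?\<pi>) \<omega>)) w (?\<pi> x) = ?\<pi> (fold (move \<omega>) w x)"
      by (rule fold_move_conj_pair) simp
    moreover have "?\<pi> x = x" "?\<pi> x0 = x0" using fresh by (auto simp: Transposition.transpose_def)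
    ultimately show "fold (move (conj_pair (\<lambda>_. ?\<pi>) \<omega>)) w x = x0 \<longleftrightarrow> fold (move \<omega>) w x = x0"
      by (metis Transposition.transpose_involutory)
  qed
qed

text \<open>Only the permutation \<open>s\<close> is conjugated: a mere count involves no path, so
  the points may be exposed in the other permutation. This gives the uniform law on all values
  outside \<open>insert u (Field (C s))\<close>.\<close>

lemma card_exchange:
  assumes y: "y \<in> {1..N}" and y': "y' \<in> {1..N}"
    and fresh: "y \<notin> insert u (Field (C s))" "y' \<notin> insert u (Field (C s))"
  shows "card (cycle_pairs N (C(s := insert (u, y) (C s)))) = card (cycle_pairs N (C(s := insert (u, y') (C s))))"
proof -
  define \<pi> where "\<pi> = (\<lambda>b. if b = s then Transposition.transpose y y' else id)"
  have relabel: "relabel \<pi> (C(s := insert (u, y) (C s))) = C(s := insert (u, y') (C s))"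
    using fresh by (auto simp: relabel_def \<pi>_def fun_eq_iff transpose_image_id map_prod.id)
  have "bij_betw (conj_pair \<pi>) (cycle_pairs N (C(s := insert (u, y) (C s))))
      (cycle_pairs N (C(s := insert (u, y') (C s))))"
    unfolding relabel[symmetric]
    by (rule bij_betw_conj_pair)
      (use permutes_swap_id[OF y y'] in \<open>auto simp: \<pi>_def\<close>)
  then show ?thesis by (rule bij_betw_same_card)
qed

lemma cycle_pairs_fibre:
  "{\<omega> \<in> cycle_pairs N C. component s \<omega> u = y} = cycle_pairs N (C(s := insert (u, y) (C s)))"
proof -
  have "(a, e) \<in> (C(s := insert (u, y) (C s))) b \<longleftrightarrow> (a, e) \<in> C b \<or> b = s \<and> a = u \<and> e = y" for a e b
    by auto
  then show ?thesis unfolding cycle_pairs_def by blast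
qed

subsection \<open>Probabilities as holomorphic functions of the inverse degree\<close>

text \<open>The value \<open>c\<close> is the limit of \<open>q N\<close> as \<open>N\<close> tends to infinity.\<close>

definition expands :: "nat \<Rightarrow> real \<Rightarrow> (nat \<Rightarrow> real) \<Rightarrow> complex \<Rightarrow> bool" where
  "expands L K q c \<longleftrightarrow> (\<exists>F. F holomorphic_on ball 0 (1 / (4 * real L)) \<and> F 0 = c \<and>
     (\<forall>z\<in>ball 0 (1 / (4 * real L)). cmod (F z) \<le> K) \<and>
     (\<forall>N. 6 dvd N \<and> 4 * L < N \<longrightarrow> complex_of_real (q N) = F (1 / of_nat N)))"

lemma expands_mono:
  assumes "expands L K q c" "K \<le> K'" "\<And>N. 6 dvd N \<Longrightarrow> 4 * L < N \<Longrightarrow> q' N = q N"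
  shows "expands L K' q' c"
proof -
  from assms(1) obtain F where F: "F holomorphic_on ball 0 (1 / (4 * real L))" "F 0 = c"
     "\<And>z. z \<in> ball 0 (1 / (4 * real L)) \<Longrightarrow> cmod (F z) \<le> K"
     "\<And>N. 6 dvd N \<Longrightarrow> 4 * L < N \<Longrightarrow> complex_of_real (q N) = F (1 / of_nat N)"
    unfolding expands_def by blast
  show ?thesis
    unfolding expands_def
  proof (intro exI[of _ F] conjI ballI allI impI)
    show "cmod (F z) \<le> K'" if "z \<in> ball 0 (1 / (4 * real L))" for z
      using F(3)[OF that] assms(2) by simp
  qed (use F assms(3) in simp_all)
qed

text \<open>Dividing by N turns the average into a function of z = 1 / N in which the terms of
  \<open>V\<close> carry a factor z and vanish at 0. On the disc k |z| \<le> 1 / 4 for every k \<le>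
  L, so the bound grows by (1 / 4 + 5 / 4) / (3 / 4) = 2.\<close>

lemma expands_average:
  assumes L: "L \<ge> 1" "card V \<le> L" "v \<le> L" "d \<le> L"
    and old: "\<And>y. y \<in> V \<Longrightarrow> expands L K (q y) (c y)" and new: "expands L K q' c'"
    and eq: "\<And>N. 6 dvd N \<Longrightarrow> 4 * L < N \<Longrightarrow>
      Q N = ((\<Sum>y\<in>V. q y N) + (real N - real v) * q' N) / (real N - real d)"
  shows "expands L (2 * K) Q c'"
proof -
  let ?B = "ball 0 (1 / (4 * real L)) :: complex set"
  have "\<exists>F. \<forall>y\<in>V. F y holomorphic_on ?B \<and> F y 0 = c y \<and> (\<forall>z\<in>?B. cmod (F y z) \<le> K) \<and>
     (\<forall>N. 6 dvd N \<and> 4 * L < N \<longrightarrow> complex_of_real (q y N) = F y (1 / of_nat N))"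
    using old unfolding expands_def by (intro bchoice) blast
  then obtain F where F: "\<And>y. y \<in> V \<Longrightarrow> F y holomorphic_on ?B"
    "\<And>y z. y \<in> V \<Longrightarrow> z \<in> ?B \<Longrightarrow> cmod (F y z) \<le> K"
    "\<And>y N. y \<in> V \<Longrightarrow> 6 dvd N \<Longrightarrow> 4 * L < N \<Longrightarrow> complex_of_real (q y N) = F y (1 / of_nat N)"
    by blast
  obtain G where G: "G holomorphic_on ?B" "G 0 = c'" "\<And>z. z \<in> ?B \<Longrightarrow> cmod (G z) \<le> K"
    "\<And>N. 6 dvd N \<Longrightarrow> 4 * L < N \<Longrightarrow> complex_of_real (q' N) = G (1 / of_nat N)"
    using new unfolding expands_def by blast
  define H where "H = (\<lambda>z. ((\<Sum>y\<in>V. z * F y z) + (1 - of_nat v * z) * G z) / (1 - of_nat d * z))"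
  have small: "real k * cmod z \<le> 1 / 4" if "z \<in> ?B" "k \<le> L" for z k
  proof -
    have "real k * cmod z \<le> real L * (1 / (4 * real L))"
      using that by (intro mult_mono) auto
    then show ?thesis using L(1) by simp
  qed
  have denom: "cmod (1 - of_nat d * z) \<ge> 3 / 4" if "z \<in> ?B" for z
    using norm_triangle_ineq2[of 1 "of_nat d * z"] small[OF that L(4)] by (simp add: norm_mult)
  then have nonzero: "1 - of_nat d * z \<noteq> 0" if "z \<in> ?B" for z using that by fastforce
  have "H holomorphic_on ?B"
    unfolding H_def by (intro holomorphic_intros F(1) G(1) nonzero)
  moreover have "H 0 = c'" by (simp add: H_def G)
  moreover have "cmod (H z) \<le> 2 * K" if z: "z \<in> ?B" for z
  proof -
    have K: "K \<ge> 0" using G(3)[OF z] norm_ge_zero order_trans by blast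
    have "cmod (\<Sum>y\<in>V. z * F y z) \<le> (\<Sum>y\<in>V. cmod z * K)"
      by (rule sum_norm_le) (simp add: norm_mult mult_left_mono F(2)[OF _ z])
    also have "\<dots> = real (card V) * cmod z * K" by simp
    also have "\<dots> \<le> 1 / 4 * K" using small[OF z L(2)] K by (intro mult_right_mono)
    finally have 1: "cmod (\<Sum>y\<in>V. z * F y z) \<le> 1 / 4 * K" .
    have "cmod (1 - of_nat v * z) \<le> 5 / 4"
      using norm_triangle_ineq4[of 1 "of_nat v * z"] small[OF z L(3)] by (simp add: norm_mult)
    then have 2: "cmod ((1 - of_nat v * z) * G z) \<le> 5 / 4 * K"
      unfolding norm_mult using G(3)[OF z] by (intro mult_mono) auto
    have "cmod ((\<Sum>y\<in>V. z * F y z) + (1 - of_nat v * z) * G z) \<le> 3 / 2 * K"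
      using norm_triangle_ineq[of "\<Sum>y\<in>V. z * F y z" "(1 - of_nat v * z) * G z"] 1 2 by simp
    then have "cmod (H z) \<le> (3 / 2 * K) / (3 / 4)"
      unfolding H_def norm_divide using denom[OF z] K by (intro frac_le) auto
    then show ?thesis by simp
  qed
  moreover have "complex_of_real (Q N) = H (1 / of_nat N)" if N: "6 dvd N" "4 * L < N" for N
  proof -
    have N0: "of_nat N \<noteq> (0 :: complex)" "of_nat N - of_nat d \<noteq> (0 :: complex)"
      using N L by auto
    have "complex_of_real (Q N) = ((\<Sum>y\<in>V. F y (1 / of_nat N)) + (of_nat N - of_nat v) * G (1 / of_nat N)) / (of_nat N - of_nat d)"
      using N by (simp add: eq F(3) G(4))
    also have "\<dots> = H (1 / of_nat N)"
      unfolding H_def sum_distrib_left[symmetric] using N0 by (simp add: divide_simps)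
    finally show ?thesis .
  qed
  ultimately show ?thesis unfolding expands_def by blast
qed

text \<open>All points above \<open>v\<close> are exchangeable, so \<open>v + 1\<close> stands for each of them. As \<open>N\<close> grows,
  the exposed value is almost surely such a new point, which is why only \<open>c (v + 1)\<close> survives.\<close>

lemma expands_expose:
  fixes C :: "bool \<Rightarrow> (nat \<times> nat) set"
  defines "E \<equiv> \<lambda>s u. insert u (Field (C s))"
  assumes L: "v + 1 \<le> L" and field: "\<And>b. Field (C b) \<subseteq> {1..v}" and pts: "{u, x, x0} \<subseteq> {1..v}"
    and nonempty: "\<And>N. 6 dvd N \<Longrightarrow> 4 * L < N \<Longrightarrow> cycle_pairs N C \<noteq> {}"
    and avoid: "\<And>N \<omega>. 4 * L < N \<Longrightarrow> \<omega> \<in> cycle_pairs N C \<Longrightarrow> component s \<omega> u \<notin> E s u"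
    and step: "\<And>y. y \<in> {1..v + 1} - E s u \<Longrightarrow>
      (\<And>N. 6 dvd N \<Longrightarrow> 4 * L < N \<Longrightarrow> cycle_pairs N (C(s := insert (u, y) (C s))) \<noteq> {}) \<Longrightarrow>
      expands L K (\<lambda>N. ratio (cycle_pairs N (C(s := insert (u, y) (C s)))) (\<lambda>\<omega>. fold (move \<omega>) w x = x0)) (c y)"
  shows "expands L (2 * K) (\<lambda>N. ratio (cycle_pairs N C) (\<lambda>\<omega>. fold (move \<omega>) w x = x0)) (c (v + 1))"
proof -
  let ?C = "\<lambda>y. C(s := insert (u, y) (C s))"
  let ?P = "\<lambda>\<omega>. fold (move \<omega>) w x = x0"
  have E: "E s u \<subseteq> {1..v}" using field pts by (auto simp: E_def)
  then have fin: "finite (E s u)" and card_E: "card (E s u) \<le> v"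
    using finite_subset card_mono[of "{1..v}" "E s u"] by auto
  have fibres: "card {\<omega> \<in> cycle_pairs N C. component s \<omega> u = y} = card {\<omega> \<in> cycle_pairs N C. component s \<omega> u = y'}"
    if "y \<in> {1..N} - E s u" "y' \<in> {1..N} - E s u" for N y y'
    unfolding cycle_pairs_fibre using that by (intro card_exchange) (auto simp: E_def)
  have image: "(\<lambda>\<omega>. component s \<omega> u) ` cycle_pairs N C \<subseteq> {1..N} - E s u" if N: "4 * L < N" for N
  proof clarify
    fix \<omega> assume \<omega>: "\<omega> \<in> cycle_pairs N C"
    then have "component s \<omega> permutes {1..N}" by (simp add: cycle_pairs_def)
    moreover have "u \<in> {1..N}" using pts L N by auto
    ultimately have "component s \<omega> u \<in> {1..N}" by (simp only: permutes_in_image)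
    with avoid[OF N \<omega>] show "component s \<omega> u \<in> {1..N} - E s u" by blast
  qed
  have exp: "expands L K (\<lambda>N. ratio (cycle_pairs N (?C y)) ?P) (c y)" if y: "y \<in> {1..v + 1} - E s u" for y
  proof (rule step[OF y])
    fix N assume N: "6 dvd N" "4 * L < N"
    have "y \<in> {1..N} - E s u" using y N L by auto
    then show "cycle_pairs N (?C y) \<noteq> {}"
      using uniform_fibre_nonempty[OF finite_cycle_pairs nonempty[OF N] image[OF N(2)] _ fibres]
      unfolding cycle_pairs_fibre by blast
  qed
  show ?thesis
  proof (rule expands_average[of L "{1..v} - E s u" v "card (E s u)" K "\<lambda>y N. ratio (cycle_pairs N (?C y)) ?P" c])
    show "1 \<le> L" "v \<le> L" "card (E s u) \<le> L" using L card_E by auto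
    show "card ({1..v} - E s u) \<le> L" using L card_mono[of "{1..v}" "{1..v} - E s u"] by auto
    show "expands L K (\<lambda>N. ratio (cycle_pairs N (?C (v + 1))) ?P) (c (v + 1))"
      using E by (intro exp) auto
    show "expands L K (\<lambda>N. ratio (cycle_pairs N (?C y)) ?P) (c y)" if "y \<in> {1..v} - E s u" for y
      using that by (intro exp) auto
    fix N assume N: "6 dvd N" "4 * L < N"
    have vN: "v + 1 \<le> N" using L N by simp
    have "ratio (cycle_pairs N C) ?P = (\<Sum>y\<in>{1..N} - E s u. ratio (cycle_pairs N (?C y)) ?P) / real (card ({1..N} - E s u))"
      using ratio_uniform_fibres[OF finite_cycle_pairs nonempty[OF N] image[OF N(2)] _ fibres]
      unfolding cycle_pairs_fibre by blast
    also have "card ({1..N} - E s u) = N - card (E s u)"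
      using E vN fin by (subst card_Diff_subset) auto
    also have "real (N - card (E s u)) = real N - real (card (E s u))"
      using card_E vN by simp
    \<comment> \<open>Seen points keep separate terms, whose number does not depend on N; the new
      points are merged by exchangeability into one term of multiplicity N - v.\<close>
    also have "{1..N} - E s u = ({1..v} - E s u) \<union> {v + 1..N}"
      using E vN by auto
    also have "(\<Sum>y\<in>\<dots>. ratio (cycle_pairs N (?C y)) ?P)
        = (\<Sum>y\<in>{1..v} - E s u. ratio (cycle_pairs N (?C y)) ?P) + (\<Sum>y\<in>{v + 1..N}. ratio (cycle_pairs N (?C y)) ?P)"
      by (rule sum.union_disjoint) auto
    also have "(\<Sum>y\<in>{v + 1..N}. ratio (cycle_pairs N (?C y)) ?P) = (\<Sum>y\<in>{v + 1..N}. ratio (cycle_pairs N (?C (v + 1))) ?P)"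
    proof (intro sum.cong refl ratio_exchange)
      fix y b assume y: "y \<in> {v + 1..N}"
      show "y \<in> {1..N}" "v + 1 \<in> {1..N}" using y vN by auto
      show "y \<notin> Field (C b)" "v + 1 \<notin> Field (C b)" using y field[of b] by auto
      show "y \<notin> {u, x, x0}" "v + 1 \<notin> {u, x, x0}" using y pts by auto
    qed
    also have "\<dots> = (real N - real v) * ratio (cycle_pairs N (?C (v + 1))) ?P"
      using vN by simp
    finally show "ratio (cycle_pairs N C) ?P = ((\<Sum>y\<in>{1..v} - E s u. ratio (cycle_pairs N (?C y)) ?P)
        + (real N - real v) * ratio (cycle_pairs N (?C (v + 1))) ?P) / (real N - real (card (E s u)))" .
  qed
qed

section \<open>The recursion along the word\<close>

lemma cycle_pairsD:
  assumes "\<omega> \<in> cycle_pairs N C"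
  shows "inj (component s \<omega>)" "x \<in> {1..N} \<Longrightarrow> component s \<omega> x \<noteq> x"
    "x \<in> {1..N} \<Longrightarrow> fst \<omega> (fst \<omega> x) = x" "x \<in> {1..N} \<Longrightarrow> snd \<omega> (snd \<omega> (snd \<omega> x)) = x"
    "(x, y) \<in> C s \<Longrightarrow> component s \<omega> x = y"
  using assms permutes_inj unfolding cycle_pairs_def by blast+

text \<open>Injectivity excludes the values already taken by other points, and the absence of fixed
  points excludes \<open>u\<close> itself.\<close>

lemma component_avoids:
  assumes "\<omega> \<in> cycle_pairs N C" "u \<in> {1..N}" "u \<notin> Domain (C s)"
  shows "component s \<omega> u \<notin> insert u (Range (C s))"
proof
  assume "component s \<omega> u \<in> insert u (Range (C s))"
  then obtain u' where "(u', component s \<omega> u) \<in> C s"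
    using cycle_pairsD(2)[OF assms(1,2)] by fastforce
  moreover from this have "u' = u"
    using cycle_pairsD(5)[OF assms(1)] injD[OF cycle_pairsD(1)[OF assms(1)]] by metis
  ultimately show False using assms(3) by blast
qed

text \<open>A step from a point whose cycle is known is deterministic; otherwise the whole cycle is exposed,
  so that the exposed part stays a union of cycles. When \<open>w\<close> is reduced and starts at a point
  where its first letter is unexposed, a path through new points only never meets a known cycle and
  cannot end at \<open>x0\<close>.\<close>

lemma expands_word:
  assumes "\<And>b. Field (C b) \<subseteq> {1..v}" "\<And>b. Domain (C b) = Range (C b)" "{x, x0} \<subseteq> {1..v}"
    and "v + 2 * length w \<le> L"
  shows "\<exists>c. ((\<forall>N. 6 dvd N \<and> 4 * L < N \<longrightarrow> cycle_pairs N C \<noteq> {}) \<longrightarrow>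
       expands L (4 ^ length w) (\<lambda>N. ratio (cycle_pairs N C) (\<lambda>\<omega>. fold (move \<omega>) w x = x0)) c) \<and>
     (reduced w \<and> (w \<noteq> [] \<longrightarrow> x \<notin> Field (C (hd w = Sb))) \<longrightarrow> c = of_bool (w = [] \<and> x = x0))"
  using assms
proof (induction w arbitrary: C v x)
  case Nil
  have "expands L 1 (\<lambda>N. ratio (cycle_pairs N C) (\<lambda>\<omega>. x = x0)) (of_bool (x = x0))"
    if "\<forall>N. 6 dvd N \<and> 4 * L < N \<longrightarrow> cycle_pairs N C \<noteq> {}"
    unfolding expands_def
  proof (intro exI[of _ "\<lambda>_. of_bool (x = x0)"] conjI allI impI)
    fix N assume N: "6 dvd N \<and> 4 * L < N"
    show "complex_of_real (ratio (cycle_pairs N C) (\<lambda>\<omega>. x = x0)) = of_bool (x = x0)"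
      using that N finite_cycle_pairs[of N C] by (simp add: ratio_def)
  qed auto
  then show ?case by auto
next
  case (Cons a w)
  note field = Cons.prems(1) and closed = Cons.prems(2) and pts = Cons.prems(3) and L = Cons.prems(4)
  let ?ne = "\<lambda>C. \<forall>N. 6 dvd N \<and> 4 * L < N \<longrightarrow> cycle_pairs N C \<noteq> {}"
  have Field_eq: "Field (C b) = Range (C b)" "Field (C b) = Domain (C b)" for b
    using closed by (simp_all add: Field_def)
  show ?case
  proof (cases "x \<in> Field (C (a = Sb))")
    case True
    have "\<exists>y. y \<in> Field (C (a = Sb)) \<and> (\<forall>N. \<forall>\<omega>\<in>cycle_pairs N C. move \<omega> a x = y)"
    proof -
      \<comment> \<open>As domain and range coincide, known arrows can be followed twice, as
        \<open>c\<^sup>2\<close> requires.\<close>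
      have next_pt: "\<exists>y\<in>Field (C b). (x, y) \<in> C b" if "x \<in> Field (C b)" for x b
        using that Field_eq unfolding Field_def by blast
      obtain y where y: "y \<in> Field (C (a = Sb))" "(x, y) \<in> C (a = Sb)" using next_pt[OF True] by blast
      obtain z where z: "z \<in> Field (C (a = Sb))" "(y, z) \<in> C (a = Sb)" using next_pt[OF y(1)] by blast
      have "component (a = Sb) \<omega> x = y" "component (a = Sb) \<omega> y = z" if "\<omega> \<in> cycle_pairs N C" for N \<omega>
        using cycle_pairsD(5)[OF that] y z by blast+
      then show ?thesis
        using y(1) z(1) by (cases a) (auto intro: exI[of _ y] exI[of _ z])
    qed
    then obtain y where y: "y \<in> Field (C (a = Sb))" "\<And>N \<omega>. \<omega> \<in> cycle_pairs N C \<Longrightarrow> move \<omega> a x = y"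
      by blast
    have "{y, x0} \<subseteq> {1..v}" using y(1) field pts by blast
    then obtain c where c: "?ne C \<Longrightarrow> expands L (4 ^ length w) (\<lambda>N. ratio (cycle_pairs N C) (\<lambda>\<omega>. fold (move \<omega>) w y = x0)) c"
      using Cons.IH[of C v y, OF field closed] L by auto
    have "expands L (4 ^ length (a # w)) (\<lambda>N. ratio (cycle_pairs N C) (\<lambda>\<omega>. fold (move \<omega>) (a # w) x = x0)) c" if "?ne C"
    proof (rule expands_mono[OF c[OF that]])
      show "ratio (cycle_pairs N C) (\<lambda>\<omega>. fold (move \<omega>) (a # w) x = x0) = ratio (cycle_pairs N C) (\<lambda>\<omega>. fold (move \<omega>) w y = x0)" for N
        by (rule ratio_cong) (simp_all add: y)
    qed simp
    then show ?thesis using True by auto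
  next
    case fresh: False
    have x: "x \<in> {1..N}" "v + 2 < N" if "4 * L < N" for N using that L pts by auto
    show ?thesis
    proof (cases "a = Sb")
      case True
      let ?C = "\<lambda>y. C(True := insert (x, y) (C True))"
      let ?D = "\<lambda>y. C(True := insert (y, x) (insert (x, y) (C True)))"
      \<comment> \<open>An involution sending x to y sends y to x, so closing the exposed part under
        cycles imposes no further condition.\<close>
      have same: "cycle_pairs N (?D y) = cycle_pairs N (?C y)" if "4 * L < N" for N y
      proof -
        have "cycle_pairs N (?D y) = {\<omega> \<in> cycle_pairs N (?C y). component True \<omega> y = x}"
          unfolding cycle_pairs_fibre by (rule arg_cong[of _ _ "cycle_pairs N"]) simp
        moreover have "component True \<omega> y = x" if "\<omega> \<in> cycle_pairs N (?C y)" for \<omega>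
          using cycle_pairsD(3)[OF that x(1)] cycle_pairsD(5)[OF that, of x y True] \<open>4 * L < N\<close> by simp
        ultimately show ?thesis by blast
      qed
      \<comment> \<open>The limits are chosen for all y at once, including values that no pair
        realises; this is why nonemptiness stands as a premise inside the existential
        statement.\<close>
      have "\<exists>c. \<forall>y\<in>{1..v + 1}. (?ne (?D y) \<longrightarrow>
            expands L (4 ^ length w) (\<lambda>N. ratio (cycle_pairs N (?D y)) (\<lambda>\<omega>. fold (move \<omega>) w y = x0)) (c y)) \<and>
         (reduced w \<and> (w \<noteq> [] \<longrightarrow> y \<notin> Field (?D y (hd w = Sb))) \<longrightarrow> c y = of_bool (w = [] \<and> y = x0))"
      proof (intro bchoice ballI Cons.IH[of _ "v + 1"])
        fix y b assume y: "y \<in> {1..v + 1}"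
        have "Field (?D y b) \<subseteq> {x, y} \<union> Field (C b)" by (cases b) auto
        then show "Field (?D y b) \<subseteq> {1..v + 1}" using field[of b] y pts by fastforce
        show "Domain (?D y b) = Range (?D y b)" by (cases b) (simp_all add: closed insert_commute)
        show "{y, x0} \<subseteq> {1..v + 1}" using y pts by auto
      qed (use L in auto)
      then obtain c where c: "\<And>y. y \<in> {1..v + 1} \<Longrightarrow> ?ne (?D y) \<Longrightarrow>
            expands L (4 ^ length w) (\<lambda>N. ratio (cycle_pairs N (?D y)) (\<lambda>\<omega>. fold (move \<omega>) w y = x0)) (c y)"
         "\<And>y. y \<in> {1..v + 1} \<Longrightarrow> reduced w \<Longrightarrow> (w \<noteq> [] \<Longrightarrow> y \<notin> Field (?D y (hd w = Sb))) \<Longrightarrow>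
            c y = of_bool (w = [] \<and> y = x0)"
        by blast
      have "expands L (2 * 4 ^ length w) (\<lambda>N. ratio (cycle_pairs N C) (\<lambda>\<omega>. fold (move \<omega>) (a # w) x = x0)) (c (v + 1))"
        if ne: "?ne C"
      proof (rule expands_expose[of v L C x x x0 True])
        show "component True \<omega> x \<notin> insert x (Field (C True))" if "4 * L < N" "\<omega> \<in> cycle_pairs N C" for N \<omega>
          using component_avoids[OF that(2) x(1)[OF that(1)], of True] fresh True by (simp add: Field_eq closed)
        fix y assume y: "y \<in> {1..v + 1} - insert x (Field (C True))"
          and ne': "\<And>N. 6 dvd N \<Longrightarrow> 4 * L < N \<Longrightarrow> cycle_pairs N (?C y) \<noteq> {}"
        have y': "y \<in> {1..v + 1}" and ne'': "?ne (?D y)" using y ne' same by simp_all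
        show "expands L (4 ^ length w) (\<lambda>N. ratio (cycle_pairs N (?C y)) (\<lambda>\<omega>. fold (move \<omega>) (a # w) x = x0)) (c y)"
        proof (rule expands_mono[OF c(1)[OF y' ne'']])
          fix N assume N: "4 * L < N"
          show "ratio (cycle_pairs N (?C y)) (\<lambda>\<omega>. fold (move \<omega>) (a # w) x = x0) =
              ratio (cycle_pairs N (?D y)) (\<lambda>\<omega>. fold (move \<omega>) w y = x0)"
          proof (rule ratio_cong[OF same[OF N, symmetric]])
            fix \<omega> assume "\<omega> \<in> cycle_pairs N (?D y)"
            from cycle_pairsD(5)[OF this, of x y True] show "fold (move \<omega>) (a # w) x = x0 \<longleftrightarrow> fold (move \<omega>) w y = x0"
              by (simp add: True)
          qed
        qed simp
      next
        show "v + 1 \<le> L" using L by simp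
      qed (use field pts ne in blast)+
      \<comment> \<open>A single exposure gives the factor 2, relaxed to the 4 allowed per
        syllable.\<close>
      then have "expands L (4 ^ length (a # w)) (\<lambda>N. ratio (cycle_pairs N C) (\<lambda>\<omega>. fold (move \<omega>) (a # w) x = x0)) (c (v + 1))"
        if "?ne C" using that by (auto intro: expands_mono)
      \<comment> \<open>The next letter, if any, belongs to the other permutation, whose exposed
        part lies below v + 1, so the path is again at an unexposed point. Without a next letter the
        path ends at v + 1, which differs from x0.\<close>
      moreover have "c (v + 1) = 0" if "reduced (a # w)"
      proof -
        have "hd w \<noteq> Sb" if "w \<noteq> []" using \<open>reduced (a # w)\<close> True that by (cases w) auto
        then have "c (v + 1) = of_bool (w = [] \<and> v + 1 = x0)"
          using field[of False] reduced_ConsD[OF that] by (intro c(2)) auto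
        then show ?thesis using pts by auto
      qed
      ultimately show ?thesis by auto
    next
      case False
      let ?C = "\<lambda>y. C(False := insert (x, y) (C False))"
      let ?C2 = "\<lambda>y z. (?C y)(False := insert (y, z) (?C y False))"
      let ?D = "\<lambda>y z. C(False := insert (z, x) (insert (y, z) (insert (x, y) (C False))))"
      let ?pos = "\<lambda>y z. if a = Sc then y else z"
      \<comment> \<open>The third arrow of the cycle is forced by the other two, so two exposures
        reveal three values.\<close>
      have same: "cycle_pairs N (?D y z) = cycle_pairs N (?C2 y z)" if "4 * L < N" for N y z
      proof -
        have "cycle_pairs N (?D y z) = {\<omega> \<in> cycle_pairs N (?C2 y z). component False \<omega> z = x}"
          unfolding cycle_pairs_fibre by (rule arg_cong[of _ _ "cycle_pairs N"]) simp
        moreover have "component False \<omega> z = x" if "\<omega> \<in> cycle_pairs N (?C2 y z)" for \<omega>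
          using cycle_pairsD(4)[OF that x(1)] cycle_pairsD(5)[OF that, of x y False]
            cycle_pairsD(5)[OF that, of y z False] \<open>4 * L < N\<close> by simp
        ultimately show ?thesis by blast
      qed
      have "\<exists>c. \<forall>p\<in>{1..v + 1} \<times> {1..v + 2}. (?ne (?D (fst p) (snd p)) \<longrightarrow>
            expands L (4 ^ length w) (\<lambda>N. ratio (cycle_pairs N (?D (fst p) (snd p)))
              (\<lambda>\<omega>. fold (move \<omega>) w (?pos (fst p) (snd p)) = x0)) (c p)) \<and>
         (reduced w \<and> (w \<noteq> [] \<longrightarrow> ?pos (fst p) (snd p) \<notin> Field (?D (fst p) (snd p) (hd w = Sb))) \<longrightarrow>
            c p = of_bool (w = [] \<and> ?pos (fst p) (snd p) = x0))"
      proof (intro bchoice ballI Cons.IH[of _ "v + 2"])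
        fix p b assume p: "p \<in> {1..v + 1} \<times> {1..v + 2}"
        then obtain y z where p_eq: "p = (y, z)" and yz: "y \<in> {1..v + 1}" "z \<in> {1..v + 2}" by auto
        have "Field (?D y z b) \<subseteq> {x, y, z} \<union> Field (C b)"
          by (cases b) auto
        then show "Field (?D (fst p) (snd p) b) \<subseteq> {1..v + 2}"
          unfolding p_eq fst_conv snd_conv using field[of b] yz pts by fastforce
        show "Domain (?D (fst p) (snd p) b) = Range (?D (fst p) (snd p) b)"
          unfolding p_eq fst_conv snd_conv by (cases b) (simp_all add: closed insert_commute)
        show "{?pos (fst p) (snd p), x0} \<subseteq> {1..v + 2}" using p_eq yz pts by auto
      qed (use L in auto)
      then obtain c where c_all: "\<forall>p\<in>{1..v + 1} \<times> {1..v + 2}. (?ne (?D (fst p) (snd p)) \<longrightarrow>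
            expands L (4 ^ length w) (\<lambda>N. ratio (cycle_pairs N (?D (fst p) (snd p)))
              (\<lambda>\<omega>. fold (move \<omega>) w (?pos (fst p) (snd p)) = x0)) (c p)) \<and>
         (reduced w \<and> (w \<noteq> [] \<longrightarrow> ?pos (fst p) (snd p) \<notin> Field (?D (fst p) (snd p) (hd w = Sb))) \<longrightarrow>
            c p = of_bool (w = [] \<and> ?pos (fst p) (snd p) = x0))" ..
      have c: "?ne (?D y z) \<Longrightarrow> expands L (4 ^ length w) (\<lambda>N. ratio (cycle_pairs N (?D y z))
              (\<lambda>\<omega>. fold (move \<omega>) w (?pos y z) = x0)) (c (y, z))"
         "reduced w \<Longrightarrow> (w \<noteq> [] \<Longrightarrow> ?pos y z \<notin> Field (?D y z (hd w = Sb))) \<Longrightarrow>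
            c (y, z) = of_bool (w = [] \<and> ?pos y z = x0)"
        if "y \<in> {1..v + 1}" "z \<in> {1..v + 2}" for y z
        using bspec[OF c_all SigmaI[OF that]] unfolding fst_conv snd_conv by blast+
      \<comment> \<open>The second exposure starts from y, with the bound v + 1 because y may itself
        be the new point. It is made for \<open>c\<close> as well, where the path stops at y, to
        keep the exposed part a union of cycles.\<close>
      have second: "expands L (2 * 4 ^ length w) (\<lambda>N. ratio (cycle_pairs N (?C y)) (\<lambda>\<omega>. fold (move \<omega>) (a # w) x = x0))
          (c (y, v + 1 + 1))"
        if y: "y \<in> {1..v + 1} - insert x (Field (C False))"
          and ne: "\<And>N. 6 dvd N \<Longrightarrow> 4 * L < N \<Longrightarrow> cycle_pairs N (?C y) \<noteq> {}" for y
      proof (rule expands_expose[of "v + 1" L "?C y" y x x0 False, where c = "\<lambda>z. c (y, z)"])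
        show "v + 1 + 1 \<le> L" using L by simp
        have "Field (?C y b) \<subseteq> {x, y} \<union> Field (C b)" for b by (cases b) auto
        then show "Field (?C y b) \<subseteq> {1..v + 1}" for b using field[of b] y pts by fastforce
        show "{y, x, x0} \<subseteq> {1..v + 1}" using y pts by auto
        show "component False \<omega> y \<notin> insert y (Field (?C y False))" if N: "4 * L < N" and \<omega>: "\<omega> \<in> cycle_pairs N (?C y)" for N \<omega>
        proof -
          have "y \<in> {1..N}" using y x(2)[OF N] by auto
          then have "component False \<omega> y \<notin> insert y (Range (C False))"
            using component_avoids[OF \<omega>, of y False] y by (simp add: Field_eq closed)
          moreover have "snd \<omega> x = y" using cycle_pairsD(5)[OF \<omega>, of x y False] by simp
          \<comment> \<open>If y went back to x, the cube would send x to y instead of x.\<close>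
          then have "snd \<omega> y \<noteq> x" using cycle_pairsD(4)[OF \<omega> x(1)[OF N]] y by auto
          ultimately show ?thesis by (simp add: Field_eq)
        qed
        fix z assume z: "z \<in> {1..v + 1 + 1} - insert y (Field (?C y False))"
          and ne': "\<And>N. 6 dvd N \<Longrightarrow> 4 * L < N \<Longrightarrow> cycle_pairs N (?C2 y z) \<noteq> {}"
        have yz: "y \<in> {1..v + 1}" "z \<in> {1..v + 2}" using y z by simp_all
        have ne'': "?ne (?D y z)" using ne' same by simp
        show "expands L (4 ^ length w) (\<lambda>N. ratio (cycle_pairs N (?C2 y z)) (\<lambda>\<omega>. fold (move \<omega>) (a # w) x = x0)) (c (y, z))"
        proof (rule expands_mono[OF c(1)[OF yz ne'']])
          fix N assume N: "4 * L < N"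
          show "ratio (cycle_pairs N (?C2 y z)) (\<lambda>\<omega>. fold (move \<omega>) (a # w) x = x0) =
              ratio (cycle_pairs N (?D y z)) (\<lambda>\<omega>. fold (move \<omega>) w (?pos y z) = x0)"
          proof (rule ratio_cong[OF same[OF N, symmetric]])
            fix \<omega> assume "\<omega> \<in> cycle_pairs N (?D y z)"
            from cycle_pairsD(5)[OF this, of x y False] cycle_pairsD(5)[OF this, of y z False]
            show "fold (move \<omega>) (a # w) x = x0 \<longleftrightarrow> fold (move \<omega>) w (?pos y z) = x0"
              using False by (cases a) simp_all
          qed
        qed simp
      qed (use ne in blast)
      have "expands L (2 * (2 * 4 ^ length w)) (\<lambda>N. ratio (cycle_pairs N C) (\<lambda>\<omega>. fold (move \<omega>) (a # w) x = x0))
          (c (v + 1, v + 1 + 1))"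
        if ne: "?ne C"
      proof (rule expands_expose[of v L C x x x0 False, where c = "\<lambda>y. c (y, v + 1 + 1)"])
        show "component False \<omega> x \<notin> insert x (Field (C False))" if "4 * L < N" "\<omega> \<in> cycle_pairs N C" for N \<omega>
          using component_avoids[OF that(2) x(1)[OF that(1)], of False] fresh False by (simp add: Field_eq closed)
        show "v + 1 \<le> L" using L by simp
        show "expands L (2 * 4 ^ length w) (\<lambda>N. ratio (cycle_pairs N (?C y)) (\<lambda>\<omega>. fold (move \<omega>) (a # w) x = x0))
            (c (y, v + 1 + 1))"
          if "y \<in> {1..v + 1} - insert x (Field (C False))"
            and "\<And>N. 6 dvd N \<Longrightarrow> 4 * L < N \<Longrightarrow> cycle_pairs N (?C y) \<noteq> {}" for y
          using that by (rule second)
      qed (use field pts ne in blast)+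
      then have "expands L (4 ^ length (a # w)) (\<lambda>N. ratio (cycle_pairs N C) (\<lambda>\<omega>. fold (move \<omega>) (a # w) x = x0))
          (c (v + 1, v + 1 + 1))"
        if "?ne C" using that by (auto intro: expands_mono)
      moreover have "c (v + 1, v + 1 + 1) = 0" if "reduced (a # w)"
      proof -
        have "hd w = Sb" if "w \<noteq> []" using \<open>reduced (a # w)\<close> False that by (cases w) auto
        then have "c (v + 1, v + 1 + 1) = of_bool (w = [] \<and> ?pos (v + 1) (v + 1 + 1) = x0)"
          using field[of True] reduced_ConsD[OF that] by (intro c(2)) auto
        then show ?thesis using pts by auto
      qed
      ultimately show ?thesis by auto
    qed
  qed
qed

section \<open>The random homomorphisms\<close>

text \<open>The orders 2 and 3 are prime, so having such an order means that the power is trivial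
  and the permutation is not the identity; for n \<ge> 1 the point 1 exists and is moved, which
  gives the latter.\<close>

lemma rand_pairs_eq:
  assumes n: "n \<ge> 1"
  shows "rand_pairs n = cycle_pairs (6 * n) (\<lambda>_. {})"
proof -
  let ?N = "6 * n" and ?S = "sym_group (6 * n)"
  interpret S: group ?S by (rule sym_group_is_group)
  have ord: "group.ord ?S p = k \<longleftrightarrow> p [^]\<^bsub>?S\<^esub> k = \<one>\<^bsub>?S\<^esub>"
    if p: "p permutes {1..?N}" "\<forall>i\<in>{1..?N}. p i \<noteq> i" and k: "prime k" for p and k :: nat
  proof -
    have carr: "p \<in> carrier ?S" using p by (simp add: sym_group_carrier)
    have "p 1 \<noteq> 1" using p n by simp
    then have "p \<noteq> \<one>\<^bsub>?S\<^esub>" by (auto simp: sym_group_one)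
    then have "S.ord p \<noteq> 1" using S.ord_eq_1[OF carr] by simp
    then show ?thesis
      unfolding S.pow_eq_id[OF carr] using k by (auto simp: prime_nat_iff)
  qed
  have pow2: "p [^]\<^bsub>?S\<^esub> (2::nat) = \<one>\<^bsub>?S\<^esub> \<longleftrightarrow> (\<forall>x\<in>{1..?N}. p (p x) = x)" if p: "p permutes {1..?N}" for p
  proof -
    have "p [^]\<^bsub>?S\<^esub> (2::nat) = p \<circ> p"
      by (simp add: numeral_2_eq_2 sym_group_mult sym_group_one)
    moreover have "p (p x) = x" if "x \<notin> {1..?N}" for x
      using permutes_not_in[OF p that] by simp
    ultimately show ?thesis by (auto simp: sym_group_one fun_eq_iff simp del: atLeastAtMost_iff)
  qed
  have pow3: "p [^]\<^bsub>?S\<^esub> (3::nat) = \<one>\<^bsub>?S\<^esub> \<longleftrightarrow> (\<forall>x\<in>{1..?N}. p (p (p x)) = x)" if p: "p permutes {1..?N}" for p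
  proof -
    have "p [^]\<^bsub>?S\<^esub> (3::nat) = p \<circ> p \<circ> p"
      by (simp add: numeral_3_eq_3 sym_group_mult sym_group_one)
    moreover have "p (p (p x)) = x" if "x \<notin> {1..?N}" for x
      using permutes_not_in[OF p that] by simp
    ultimately show ?thesis by (auto simp: sym_group_one fun_eq_iff simp del: atLeastAtMost_iff)
  qed
  have "(\<sigma>, \<tau>) \<in> rand_pairs n \<longleftrightarrow> (\<sigma>, \<tau>) \<in> cycle_pairs ?N (\<lambda>_. {})" for \<sigma> \<tau>
  proof (cases "\<sigma> permutes {1..?N} \<and> (\<forall>i\<in>{1..?N}. \<sigma> i \<noteq> i) \<and> \<tau> permutes {1..?N} \<and> (\<forall>i\<in>{1..?N}. \<tau> i \<noteq> i)")
    case True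
    then show ?thesis
      using ord[of \<sigma> 2] ord[of \<tau> 3] pow2[of \<sigma>] pow3[of \<tau>]
      by (simp add: rand_pairs_def cycle_pairs_def sym_group_carrier all_bool)
  next
    case False
    then show ?thesis
      by (auto simp: rand_pairs_def cycle_pairs_def sym_group_carrier all_bool)
  qed
  then show ?thesis by auto
qed

text \<open>Blocks of consecutive points are permuted, pairs by the involution and triples by the
  other permutation. Divisibility by 6 makes both partitions of \<open>{1..N}\<close> exact.\<close>

lemma cycle_pairs_nonempty: "6 dvd N \<Longrightarrow> cycle_pairs N (\<lambda>_. {}) \<noteq> {}"
proof -
  assume "6 dvd N"
  then obtain n where N: "N = 6 * n" by blast
  define \<sigma> where "\<sigma> x = (if x \<in> {1..N} then (if even x then x - 1 else x + 1) else x)" for x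
  define \<tau> where "\<tau> x = (if x \<in> {1..N} then (if x mod 3 = 0 then x - 2 else x + 1) else x)" for x
  have \<sigma>_values: "\<sigma> (2 * k + 1) = 2 * k + 2" "\<sigma> (2 * k + 2) = 2 * k + 1" if "k < 3 * n" for k
    using that by (simp_all add: \<sigma>_def N)
  have \<tau>_values: "\<tau> (3 * k + 1) = 3 * k + 2" "\<tau> (3 * k + 2) = 3 * k + 3" "\<tau> (3 * k + 3) = 3 * k + 1"
    if "k < 2 * n" for k
  proof -
    have "(3 * k + 1) mod 3 = 1" "(3 * k + 2) mod 3 = 2" "(3 * k + 3) mod 3 = 0" by presburger+
    then show "\<tau> (3 * k + 1) = 3 * k + 2" "\<tau> (3 * k + 2) = 3 * k + 3" "\<tau> (3 * k + 3) = 3 * k + 1"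
      using that by (simp_all add: \<tau>_def N)
  qed
  have \<sigma>: "\<sigma> (\<sigma> x) = x \<and> (x \<in> {1..N} \<longrightarrow> \<sigma> x \<noteq> x)" for x
  proof (cases "x \<in> {1..N}")
    case True
    then have "(x - 1) div 2 < 3 * n" "x = 2 * ((x - 1) div 2) + 1 \<or> x = 2 * ((x - 1) div 2) + 2"
      unfolding N atLeastAtMost_iff by presburger+
    then obtain k where "k < 3 * n" "x = 2 * k + 1 \<or> x = 2 * k + 2" by blast
    then show ?thesis using \<sigma>_values[of k] by auto
  next
    case False
    then have "\<sigma> x = x" unfolding \<sigma>_def by (rule if_not_P)
    then show ?thesis using False by simp
  qed
  have \<tau>: "\<tau> (\<tau> (\<tau> x)) = x \<and> (x \<in> {1..N} \<longrightarrow> \<tau> x \<noteq> x)" for x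
  proof (cases "x \<in> {1..N}")
    case True
    define k where "k = (x - 1) div 3"
    have "x - 1 = 3 * k + (x - 1) mod 3" "(x - 1) mod 3 < 3" by (simp_all add: k_def)
    then have "k < 2 * n" "x = 3 * k + 1 \<or> x = 3 * k + 2 \<or> x = 3 * k + 3"
      using True unfolding N atLeastAtMost_iff by linarith+
    then show ?thesis using \<tau>_values[of k] by auto
  next
    case False
    then have "\<tau> x = x" unfolding \<tau>_def by (rule if_not_P)
    then show ?thesis using False by simp
  qed
  have "\<sigma> permutes {1..N}"
    unfolding permutes_def
  proof (intro conjI allI impI)
    show "\<exists>!x. \<sigma> x = y" for y using \<sigma> by metis
  qed (unfold \<sigma>_def, rule if_not_P)
  moreover have "\<tau> permutes {1..N}"
    unfolding permutes_def
  proof (intro conjI allI impI)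
    show "\<exists>!x. \<tau> x = y" for y using \<tau> by metis
  qed (unfold \<tau>_def, rule if_not_P)
  ultimately have "(\<sigma>, \<tau>) \<in> cycle_pairs N (\<lambda>_. {})"
    using \<sigma> \<tau> by (auto simp: cycle_pairs_def all_bool)
  then show ?thesis by blast
qed

lemma order_2_3_monoid_sym_group:
  assumes "\<omega> \<in> cycle_pairs N (\<lambda>_. {})"
  shows "order_2_3_monoid (sym_group N) (fst \<omega>) (snd \<omega>)"
proof -
  interpret S: group "sym_group N" by (rule sym_group_is_group)
  have p: "fst \<omega> permutes {1..N}" "snd \<omega> permutes {1..N}"
    using assms by (simp_all add: cycle_pairs_def all_bool)
  have "fst \<omega> (fst \<omega> x) = x" "snd \<omega> (snd \<omega> (snd \<omega> x)) = x" for x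
    using cycle_pairsD(3,4)[OF assms, of x] permutes_not_in[OF p(1), of x] permutes_not_in[OF p(2), of x]
    by (cases "x \<in> {1..N}"; simp)+
  then show ?thesis
    using p by unfold_locales (auto simp: sym_group_carrier sym_group_mult sym_group_one)
qed

text \<open>Products are compositions of maps, so the last letter of a word moves the point first,
  and the path reads the reversed word.\<close>

lemma Phi_apply:
  assumes "\<omega> \<in> cycle_pairs (6 * n) (\<lambda>_. {})"
  shows "Phi n \<omega> (PSL2Z_eval w) permutes {1..6 * n}"
    and "Phi n \<omega> (PSL2Z_eval w) x = fold (move \<omega>) (rev w) x"
proof -
  interpret S: order_2_3_monoid "sym_group (6 * n)" "fst \<omega>" "snd \<omega>"
    by (rule order_2_3_monoid_sym_group[OF assms])
  have Phi: "Phi n \<omega> (PSL2Z_eval w) = S.weval w"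
    using Phi_eval[OF S.order_2_3_monoid_axioms] by simp
  show "Phi n \<omega> (PSL2Z_eval w) permutes {1..6 * n}"
    unfolding Phi using S.weval_closed[of w] by (simp add: sym_group_carrier)
  have "S.letter a x = move \<omega> a x" for a x
    by (cases a) (simp_all add: sym_group_mult)
  then have "S.weval w x = foldr (move \<omega>) w x"
    by (induction w) (simp_all add: sym_group_mult sym_group_one)
  then show "Phi n \<omega> (PSL2Z_eval w) x = fold (move \<omega>) (rev w) x"
    by (simp add: Phi foldr_conv_fold)
qed

text \<open>Conjugating both permutations by the transposition of x and y preserves the set of pairs
  and carries loops at x to loops at y.\<close>

lemma ratio_fixed_point_eq:
  assumes "x \<in> {1..N}" "y \<in> {1..N}"
  shows "ratio (cycle_pairs N (\<lambda>_. {})) (\<lambda>\<omega>. fold (move \<omega>) w x = x)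
       = ratio (cycle_pairs N (\<lambda>_. {})) (\<lambda>\<omega>. fold (move \<omega>) w y = y)"
proof -
  let ?\<pi> = "Transposition.transpose x y"
  have "relabel (\<lambda>_. ?\<pi>) (\<lambda>_. {}) = (\<lambda>_. {})" by (simp add: relabel_def fun_eq_iff)
  then have bij: "bij_betw (conj_pair (\<lambda>_. ?\<pi>)) (cycle_pairs N (\<lambda>_. {})) (cycle_pairs N (\<lambda>_. {}))"
    using bij_betw_conj_pair[OF permutes_swap_id[OF assms], of "\<lambda>_. {}"] by simp
  show ?thesis
  proof (rule ratio_bij[OF bij])
    fix \<omega>
    have "fold (move (conj_pair (\<lambda>_. ?\<pi>) \<omega>)) w (?\<pi> x) = ?\<pi> (fold (move \<omega>) w x)"
      by (rule fold_move_conj_pair) simp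
    then show "fold (move (conj_pair (\<lambda>_. ?\<pi>) \<omega>)) w y = y \<longleftrightarrow> fold (move \<omega>) w x = x"
      by (metis Transposition.transpose_involutory transpose_apply_first)
  qed
qed

text \<open>Linearity of expectation over the N points, whose return probabilities agree: the
  normalisation cancels their number, and the removed invariant direction leaves - 1 / N.\<close>

lemma expectation_tr_Pi:
  assumes n: "n \<ge> 1"
  shows "measure_pmf.expectation (pmf_of_set (rand_pairs n)) (tr_Pi n (PSL2Z_eval w)) =
    complex_of_real (ratio (cycle_pairs (6 * n) (\<lambda>_. {})) (\<lambda>\<omega>. fold (move \<omega>) (rev w) 1 = 1) - 1 / real (6 * n))"
proof -
  define N where "N = 6 * n"
  define A where "A = cycle_pairs N (\<lambda>_. {})"
  have N: "N \<ge> 1" "6 dvd N" using n by (auto simp: N_def)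
  have A: "rand_pairs n = A" "finite A" "A \<noteq> {}"
    using rand_pairs_eq[OF n] cycle_pairs_nonempty[OF N(2)] finite_cycle_pairs by (auto simp: A_def N_def)
  have cA: "real (card A) \<noteq> 0" using A by simp
  have tr: "tr_Pi n (PSL2Z_eval w) \<omega> =
      complex_of_real ((real (card {x \<in> {1..N}. fold (move \<omega>) (rev w) x = x}) - 1) / real N)" if "\<omega> \<in> A" for \<omega>
  proof -
    have *: "\<omega> \<in> cycle_pairs (6 * n) (\<lambda>_. {})" using that by (simp add: A_def N_def)
    have "6 * n \<ge> 1" using n by simp
    then show ?thesis
      unfolding tr_Pi_def N_def trace_std_rep[OF \<open>6 * n \<ge> 1\<close> Phi_apply(1)[OF *]] Phi_apply(2)[OF *] by simp
  qed
  have count: "(\<Sum>\<omega>\<in>A. real (card {x \<in> {1..N}. fold (move \<omega>) (rev w) x = x})) =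
      real N * (real (card A) * ratio A (\<lambda>\<omega>. fold (move \<omega>) (rev w) 1 = 1))"
  proof -
    have "(\<Sum>\<omega>\<in>A. real (card {x \<in> {1..N}. fold (move \<omega>) (rev w) x = x})) =
        (\<Sum>\<omega>\<in>A. \<Sum>x\<in>{1..N}. of_bool (fold (move \<omega>) (rev w) x = x))"
      by (intro sum.cong refl) (simp add: Int_def)
    also have "\<dots> = (\<Sum>x\<in>{1..N}. \<Sum>\<omega>\<in>A. of_bool (fold (move \<omega>) (rev w) x = x))"
      by (rule sum.swap)
    also have "\<dots> = (\<Sum>x\<in>{1..N}. real (card A) * ratio A (\<lambda>\<omega>. fold (move \<omega>) (rev w) x = x))"
      using A cA by (intro sum.cong refl) (simp add: ratio_def Int_def)
    also have "\<dots> = (\<Sum>x\<in>{1..N}. real (card A) * ratio A (\<lambda>\<omega>. fold (move \<omega>) (rev w) 1 = 1))"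
    proof (intro sum.cong refl arg_cong2[of _ _ _ _ "(*)"])
      fix x assume "x \<in> {1..N}"
      then show "ratio A (\<lambda>\<omega>. fold (move \<omega>) (rev w) x = x) = ratio A (\<lambda>\<omega>. fold (move \<omega>) (rev w) 1 = 1)"
        unfolding A_def using N(1) by (intro ratio_fixed_point_eq) auto
    qed
    finally show ?thesis by simp
  qed
  have "measure_pmf.expectation (pmf_of_set A) (tr_Pi n (PSL2Z_eval w)) =
      (\<Sum>\<omega>\<in>A. pmf (pmf_of_set A) \<omega> *\<^sub>R tr_Pi n (PSL2Z_eval w) \<omega>)"
    using A by (intro integral_measure_pmf) auto
  also have "\<dots> = (\<Sum>\<omega>\<in>A. complex_of_real (1 / real (card A) *
      ((real (card {x \<in> {1..N}. fold (move \<omega>) (rev w) x = x}) - 1) / real N)))"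
    using A by (intro sum.cong refl) (simp add: tr scaleR_conv_of_real)
  also have "\<dots> = complex_of_real (1 / real (card A) *
      (((\<Sum>\<omega>\<in>A. real (card {x \<in> {1..N}. fold (move \<omega>) (rev w) x = x})) - real (card A)) / real N))"
    unfolding of_real_sum[symmetric]
    by (simp only: sum_distrib_left[symmetric] sum_divide_distrib[symmetric] sum_subtractf) simp
  also have "\<dots> = complex_of_real (ratio A (\<lambda>\<omega>. fold (move \<omega>) (rev w) 1 = 1) - 1 / real N)"
    unfolding count using cA N(1) by (intro arg_cong[of _ _ complex_of_real]) (simp add: field_simps)
  finally show ?thesis by (simp only: A(1) A_def N_def)
qed

section \<open>The canonical trace\<close>

lemma canonical_trace_left_regular:
  assumes "group G" "g \<in> carrier G"
  shows "canonical_trace G (left_regular G g) = of_bool (g = \<one>\<^bsub>G\<^esub>)"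
proof -
  interpret group G by fact
  have "delta_one G \<in> ell2 G"
  proof -
    have "finite {x \<in> carrier G. (cmod (delta_one G x))\<^sup>2 \<noteq> 0}"
      by (rule finite_subset[of _ "{\<one>\<^bsub>G\<^esub>}"]) (auto simp: delta_one_def)
    then show ?thesis
      by (auto simp: ell2_def delta_one_def intro: finite_nonzero_values_imp_summable_on)
  qed
  then have "canonical_trace G (left_regular G g) =
      (\<Sum>\<^sub>\<infinity>x\<in>carrier G. cnj (delta_one G x) * delta_one G (inv\<^bsub>G\<^esub> g \<otimes>\<^bsub>G\<^esub> x))"
    by (auto simp: canonical_trace_def ell2_inner_def left_regular_def intro!: infsum_cong)
  also have "\<dots> = (\<Sum>\<^sub>\<infinity>x\<in>{\<one>\<^bsub>G\<^esub>}. cnj (delta_one G x) * delta_one G (inv\<^bsub>G\<^esub> g \<otimes>\<^bsub>G\<^esub> x))"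
    by (rule infsum_cong_neutral) (auto simp: delta_one_def)
  also have "\<dots> = of_bool (g = \<one>\<^bsub>G\<^esub>)"
    using assms(2) by (auto simp: delta_one_def)
  finally show ?thesis .
qed

section \<open>The asymptotic expansion\<close>

text \<open>The tail of the power series is dominated by a geometric series. Cauchy's estimates are
  taken on a circle of radius \<open>r\<close> strictly inside the disc, where \<open>F\<close> is
  continuous up to the boundary.\<close>

lemma taylor_remainder:
  fixes F :: "complex \<Rightarrow> complex"
  assumes F: "F holomorphic_on ball 0 R" and K: "\<And>z. z \<in> ball 0 R \<Longrightarrow> cmod (F z) \<le> K"
    and r: "0 < r" "r < R" and z: "cmod z < r"
  shows "cmod (F z - (\<Sum>i<m. (deriv ^^ i) F 0 / fact i * z ^ i)) \<le> K * (cmod z / r) ^ m / (1 - cmod z / r)"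
proof -
  define a where "a i = (deriv ^^ i) F 0 / fact i" for i
  define q where "q = cmod z / r"
  have q: "0 \<le> q" "q < 1" using r z by (auto simp: q_def)
  have a: "cmod (a i) \<le> K / r ^ i" for i
  proof -
    have "F holomorphic_on ball 0 r" "continuous_on (cball 0 r) F"
      using r by (auto intro!: holomorphic_on_subset[OF F] holomorphic_on_imp_continuous_on)
    then have "cmod ((deriv ^^ i) F 0) \<le> fact i * K / r ^ i"
      using r by (intro Cauchy_inequality) (auto intro!: K)
    then show ?thesis by (simp add: a_def norm_divide field_simps)
  qed
  have "(\<lambda>i. a i * z ^ i) sums F z"
    using holomorphic_power_series[OF F, of z] r z by (simp add: a_def)
  then have "(\<lambda>i. a (i + m) * z ^ (i + m)) sums (F z - (\<Sum>i<m. a i * z ^ i))"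
    by (rule sums_split_initial_segment)
  moreover have "(\<lambda>i. K * q ^ m * q ^ i) sums (K * q ^ m * (1 / (1 - q)))"
    using q by (intro sums_mult geometric_sums) simp
  moreover have "cmod (a (i + m) * z ^ (i + m)) \<le> K * q ^ m * q ^ i" for i
  proof -
    have "cmod (a (i + m) * z ^ (i + m)) \<le> K / r ^ (i + m) * cmod z ^ (i + m)"
      unfolding norm_mult norm_power by (intro mult_right_mono a) simp
    also have "\<dots> = K * q ^ m * q ^ i"
      by (simp add: q_def power_add power_divide mult_ac)
    finally show ?thesis .
  qed
  ultimately have "cmod (F z - (\<Sum>i<m. a i * z ^ i)) \<le> K * q ^ m * (1 / (1 - q))"
    by (rule norm_sums_le)
  then show ?thesis by (simp add: a_def q_def)
qed

text \<open>The ratio 8 L / N comes from a Taylor estimate with radius 1 / (8 L), half of that in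
  \<open>expands\<close>. With L < 2 m and 18 m \<le> N it is at most 8 / 9, so the geometric tail
  costs a factor 9. There remains 9 (4 * 16 m)^m, and 9 * 64 = 576 is far below 18 ^ 18.\<close>

lemma remainder_bound:
  fixes m N L :: nat
  assumes m: "m \<ge> 1" and L: "1 \<le> L" "L \<le> 2 * m - 1" and N: "18 * m ^ 18 \<le> N"
    and K: "0 \<le> K" "K \<le> 4 ^ m"
  shows "8 * L < N" "K * (8 * real L / real N) ^ m / (1 - 8 * real L / real N) \<le> real (18 * m) ^ (18 * m) / real N ^ m"
proof -
  have "m ^ 1 \<le> m ^ 18" using m by (intro power_increasing) auto
  then have mN: "18 * m \<le> N" using N by simp
  then show "8 * L < N" using m L by linarith
  have N0: "real N > 0" using mN m by simp
  have "9 * (8 * real L) \<le> 8 * real N" using L mN m by linarith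
  then have q: "8 * real L / real N \<le> 8 / 9" using N0 by (simp add: field_simps)
  have "8 * real L / real N \<le> 16 * real m / real N"
    using L by (intro divide_right_mono) auto
  then have "K * (8 * real L / real N) ^ m \<le> 4 ^ m * (16 * real m / real N) ^ m"
    using K by (intro mult_mono power_mono) auto
  then have "K * (8 * real L / real N) ^ m / (1 - 8 * real L / real N) \<le> (4 ^ m * (16 * real m / real N) ^ m) / (1 / 9)"
    using q by (intro frac_le) auto
  also have "\<dots> = 9 * (64 * real m) ^ m / real N ^ m"
  proof -
    have "(64 * real m) ^ m = 4 ^ m * (16 * real m) ^ m"
      by (subst power_mult_distrib[symmetric]) simp
    then show ?thesis by (auto simp: power_divide)
  qed
  also have "\<dots> \<le> real (18 * m) ^ (18 * m) / real N ^ m"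
  proof (rule divide_right_mono)
    have "9 * (64 * real m) ^ m \<le> 9 ^ m * (64 * real m) ^ m"
      using m by (intro mult_right_mono) (simp_all add: self_le_power)
    also have "\<dots> = (576 * real m) ^ m"
      by (subst power_mult_distrib[symmetric]) simp
    also have "\<dots> \<le> ((18 * real m) ^ 18) ^ m"
    proof (rule power_mono)
      have "576 * real m \<le> 18 ^ 18 * real m" by simp
      also have "\<dots> \<le> 18 ^ 18 * real m ^ 18" using m by (intro mult_left_mono self_le_power) auto
      finally show "576 * real m \<le> (18 * real m) ^ 18" by (simp add: power_mult_distrib)
    qed simp
    also have "\<dots> = real (18 * m) ^ (18 * m)" by (simp add: power_mult)
    finally show "9 * (64 * real m) ^ m \<le> real (18 * m) ^ (18 * m)" .
  qed simp
  finally show "K * (8 * real L / real N) ^ m / (1 - 8 * real L / real N) \<le> real (18 * m) ^ (18 * m) / real N ^ m" .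
qed

theorem proposition1p2:
  fixes \<gamma> :: "int mat set"
  assumes "\<gamma> \<in> carrier PSL2Z"
  shows "\<exists>u :: nat \<Rightarrow> real.
    complex_of_real (u 0) = canonical_trace PSL2Z (left_regular PSL2Z \<gamma>) \<and>
    (\<forall>m n :: nat.
       m \<ge> word_length PSL2Z {PSL2Z_b, PSL2Z_c} \<gamma> + 1 \<and> n \<ge> 1 \<and> 6 * n \<ge> 18 * m ^ 18 \<longrightarrow>
       cmod (measure_pmf.expectation (pmf_of_set (rand_pairs n)) (tr_Pi n \<gamma>)
             - complex_of_real (\<Sum>i<m. u i / real (6 * n) ^ i))
         \<le> real (18 * m) ^ (18 * m) / real (6 * n) ^ m)"
proof -
  obtain w where w: "reduced w" "PSL2Z_eval w = \<gamma>"
    "length w \<le> word_length PSL2Z {PSL2Z_b, PSL2Z_c} \<gamma>"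
    using reduced_word_of_word_length[OF assms] .
  \<comment> \<open>The starting point and at most two new points per syllable.\<close>
  define L where "L = 1 + 2 * length w"
  let ?q = "\<lambda>N. ratio (cycle_pairs N (\<lambda>_. {})) (\<lambda>\<omega>. fold (move \<omega>) (rev w) 1 = 1)"
  have "expands L (4 ^ length w) ?q (of_bool (w = []))"
    using expands_word[of "\<lambda>_. {}" 1 1 1 "rev w" L] w(1) cycle_pairs_nonempty
    by (auto simp: L_def reduced_rev)
  then obtain F where F: "F holomorphic_on ball 0 (1 / (4 * real L))" "F 0 = of_bool (w = [])"
    "\<And>z. z \<in> ball 0 (1 / (4 * real L)) \<Longrightarrow> cmod (F z) \<le> 4 ^ length w"
    "\<And>N. 6 dvd N \<Longrightarrow> 4 * L < N \<Longrightarrow> complex_of_real (?q N) = F (1 / of_nat N)"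
    unfolding expands_def by blast
  have L: "L \<ge> 1" by (simp add: L_def)
  \<comment> \<open>The term z is the 1 / N by which the expectation differs from the return
    probability; it vanishes at 0, so the leading coefficient is that of \<open>F\<close>.\<close>
  define G where "G z = F z - z" for z
  define K :: real where "K = 4 ^ length w + 1"
  have G: "G holomorphic_on ball 0 (1 / (4 * real L))"
    unfolding G_def by (intro holomorphic_intros F(1))
  have G_bound: "cmod (G z) \<le> K" if "z \<in> ball 0 (1 / (4 * real L))" for z
  proof -
    have "1 / (4 * real L) \<le> 1" using L by simp
    then have "cmod z \<le> 1" using that by simp
    then show ?thesis
      unfolding G_def K_def using norm_triangle_ineq4[of "F z" z] F(3)[OF that] by linarith
  qed
  define a where "a i = (deriv ^^ i) G 0 / fact i" for i
  have "\<gamma> = \<one>\<^bsub>PSL2Z\<^esub> \<longleftrightarrow> w = []"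
    using w PSL2Z_eval_faithful by auto
  then have "complex_of_real (Re (a 0)) = canonical_trace PSL2Z (left_regular PSL2Z \<gamma>)"
    unfolding canonical_trace_left_regular[OF group_PSL2Z assms] by (simp add: a_def G_def F(2))
  moreover have "cmod (measure_pmf.expectation (pmf_of_set (rand_pairs n)) (tr_Pi n \<gamma>)
             - complex_of_real (\<Sum>i<m. Re (a i) / real (6 * n) ^ i))
         \<le> real (18 * m) ^ (18 * m) / real (6 * n) ^ m"
    if m: "m \<ge> word_length PSL2Z {PSL2Z_b, PSL2Z_c} \<gamma> + 1" and n: "n \<ge> 1" and N: "6 * n \<ge> 18 * m ^ 18" for m n
  proof -
    have m1: "m \<ge> 1" and wm: "length w + 1 \<le> m" using m w(3) by auto
    \<comment> \<open>Here m > |gamma| enters: one more factor 4 absorbs the summand 1 of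
      \<open>K\<close>, and the result is still at most 4 ^ m.\<close>
    have "(1 :: real) \<le> 4 ^ length w" by (rule one_le_power) simp
    then have "K \<le> 4 ^ (length w + 1)"
      by (simp only: K_def power_add power_one_right)
    also have "\<dots> \<le> 4 ^ m" using wm by (intro power_increasing) auto
    finally have K: "0 \<le> K" "K \<le> 4 ^ m" by (simp_all add: K_def)
    have "L \<le> 2 * m - 1" using wm by (simp add: L_def)
    note bound = remainder_bound[OF m1 L this N K]
    define t :: complex where "t = 1 / of_nat (6 * n)"
    have t: "cmod t = 1 / real (6 * n)" by (simp add: t_def norm_divide)
    have qt: "cmod t / (1 / (8 * real L)) = 8 * real L / real (6 * n)" by (simp add: t)
    have small: "cmod t < 1 / (8 * real L)"
      unfolding t using bound(1) L n by (intro divide_strict_left_mono) (simp_all flip: of_nat_mult)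
    have t_power: "t ^ i = complex_of_real (1 / real (6 * n) ^ i)" for i
      by (simp add: t_def power_divide)
    have G_real: "G t = complex_of_real (?q (6 * n) - 1 / real (6 * n))"
      using F(4)[of "6 * n"] bound(1) by (simp add: G_def t_def)
    have E: "measure_pmf.expectation (pmf_of_set (rand_pairs n)) (tr_Pi n \<gamma>) = G t"
      unfolding G_real using expectation_tr_Pi[OF n, of w] by (simp only: w(2))
    \<comment> \<open>The expectation and \<open>t\<close> are real, so replacing the coefficients
      by their real parts amounts to taking the real part of the remainder, which does not increase
      its modulus.\<close>
    have "G t - complex_of_real (\<Sum>i<m. Re (a i) / real (6 * n) ^ i) = complex_of_real (Re (G t - (\<Sum>i<m. a i * t ^ i)))"
      unfolding t_power by (simp add: G_real)
    then have "cmod (G t - complex_of_real (\<Sum>i<m. Re (a i) / real (6 * n) ^ i)) \<le> cmod (G t - (\<Sum>i<m. a i * t ^ i))"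
      using abs_Re_le_cmod by (metis norm_of_real)
    also have "\<dots> \<le> K * (cmod t / (1 / (8 * real L))) ^ m / (1 - cmod t / (1 / (8 * real L)))"
      unfolding a_def using L small by (intro taylor_remainder[OF G G_bound]) (auto simp: field_simps)
    also have "\<dots> \<le> real (18 * m) ^ (18 * m) / real (6 * n) ^ m"
      unfolding qt by (rule bound(2))
    finally show ?thesis unfolding E .
  qed
  ultimately show ?thesis by (intro exI[of _ "\<lambda>i. Re (a i)"]) blast
qed

end
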